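(* Let $K$ be a field, let $s\ge 1$ be an integer, let $B$ be a polynomial ring in $s$ variables over $K$, and let $J\subset B$ be a nonzero proper complete intersection monomial ideal. Then: (1) $\operatorname{sdepth}_B(B/J^n)=\dim(B/J)$ for all integers $n\ge 1$, and $\operatorname{sdepth}_B(J^n/J^{n+1})=\dim(B/J)$ for all integers $n\ge 0$. (2) $\operatorname{sdepth}_B(J^n)=\dim(B/J)+1$ for all integers $n\ge s-\dim(B/J)-1$.
   Context: A monomial ideal is a complete intersection if its minimal monomial generators form a regular sequence, equivalently, if they have pairwise disjoint supports (no variable divides two distinct minimal generators). $\dim$ is Krull dimension, and $J^0=B$. Stanley depth: let $S$ be a polynomial ring over $K$ in $N$ variables $x_1,\ldots,x_N$ and let $M$ be a finitely generated $\mathbb Z^N$-graded $S$-module. A Stanley decomposition of $M$ is a finite direct sum decomposition $\mathcal D: M=\bigoplus_{i=1}^{q} m_iK[Z_i]$ as a $\mathbb Z^N$-graded $K$-vector space, where each $m_i\in M$ is homogeneous, $Z_i\subset\{x_1,\ldots,x_N\}$, and $m_iK[Z_i]=\{um_i: u\in K[Z_i]\}$ is a free $K[Z_i]$-submodule of $M$. Put $\operatorname{sdepth}(\mathcal D)=\min_i|Z_i|$ and let $\operatorname{sdepth}_S(M)$ be the maximum of $\operatorname{sdepth}(\mathcal D)$ over all Stanley decompositions $\mathcal D$ of $M$. *)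

theory Defs
  imports
    "HOL-Library.Poly_Mapping"
    "HOL-Library.Extended_Nat"
    "HOL-Library.FuncSet"
    "HOL-Library.Cardinality"
    "HOL-Algebra.Ideal_Product"
    "HOL-Algebra.QuotRing"
    "HOL-Algebra.Module"
    "HOL-Algebra.Algebraic_Closure_Type"
begin

text \<open>
  Polynomials over \<open>'k\<close> in the variables \<open>'v\<close>: exponent vectors are finitely supported functions
  \<open>'v \<Rightarrow> nat\<close>, and a polynomial is a finitely supported function from exponent vectors to \<open>'k\<close>
  with the convolution product. For finite \<open>'v\<close> the number of variables is \<open>CARD('v)\<close>.
\<close>

type_synonym ('v, 'k) mpoly = "('v \<Rightarrow>\<^sub>0 nat) \<Rightarrow>\<^sub>0 'k"

abbreviation polynomial_ring :: "('v, 'k::field) mpoly ring"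
  where "polynomial_ring \<equiv> ring_of_type_algebra"

definition monomial :: "('v \<Rightarrow>\<^sub>0 nat) \<Rightarrow> ('v, 'k::field) mpoly"
  where "monomial t = Poly_Mapping.single t 1"

definition polynomials_in :: "'v set \<Rightarrow> ('v, 'k::field) mpoly set"
  where "polynomials_in Z = {u. \<forall>t \<in> Poly_Mapping.keys u. Poly_Mapping.keys t \<subseteq> Z}"

definition krull_dim :: "('a, 'b) ring_scheme \<Rightarrow> enat"
  where "krull_dim R =
    Sup {enat n | n. \<exists>p. (\<forall>i\<le>n. primeideal (p i) R) \<and> (\<forall>i<n. p i \<subset> p (Suc i))}"

text \<open>The last conjunct says that \<open>as ! i\<close> is a nonzerodivisor on \<open>R / (as ! 0, \<dots>, as ! (i - 1))\<close>.\<close>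

definition regular_sequence :: "('a, 'b) ring_scheme \<Rightarrow> 'a list \<Rightarrow> bool"
  where "regular_sequence R as \<longleftrightarrow>
    set as \<subseteq> carrier R \<and>
    Idl\<^bsub>R\<^esub> (set as) \<noteq> carrier R \<and>
    (\<forall>i < length as. \<forall>b \<in> carrier R.
       as ! i \<otimes>\<^bsub>R\<^esub> b \<in> Idl\<^bsub>R\<^esub> (set (take i as)) \<longrightarrow> b \<in> Idl\<^bsub>R\<^esub> (set (take i as)))"

definition monomial_ideal :: "('v, 'k::field) mpoly set \<Rightarrow> bool"
  where "monomial_ideal I \<longleftrightarrow> (\<exists>T. I = Idl\<^bsub>polynomial_ring\<^esub> (monomial ` T))"

definition minimal_monomial_generators :: "('v, 'k::field) mpoly set \<Rightarrow> ('v \<Rightarrow>\<^sub>0 nat) set \<Rightarrow> bool"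
  where "minimal_monomial_generators I T \<longleftrightarrow>
    Idl\<^bsub>polynomial_ring\<^esub> (monomial ` T) = I \<and>
    (\<forall>T'. T' \<subset> T \<longrightarrow> Idl\<^bsub>polynomial_ring\<^esub> (monomial ` T') \<noteq> I)"

text \<open>
  A monomial ideal has exactly one minimal set of monomial generators, so the quantifier over
  \<open>ts\<close> only chooses the order in which they are listed.
\<close>

definition complete_intersection :: "('v, 'k::field) mpoly set \<Rightarrow> bool"
  where "complete_intersection I \<longleftrightarrow>
    (\<exists>ts. distinct ts \<and> minimal_monomial_generators I (set ts) \<and>
          regular_sequence polynomial_ring (map monomial ts :: ('v, 'k) mpoly list))"

text \<open>The unit of \<open>ideals_set R\<close> is \<open>carrier R\<close>, so the zeroth power is the whole ring.\<close>

abbreviation ideal_power :: "('v, 'k::field) mpoly set \<Rightarrow> nat \<Rightarrow> ('v, 'k) mpoly set"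
  where "ideal_power I n \<equiv> I [^]\<^bsub>ideals_set polynomial_ring\<^esub> n"

text \<open>
  Modules together with the family of their homogeneous components. The fields \<open>mult\<close> and \<open>one\<close>
  that the library's module record inherits from rings play no role below.
\<close>

record ('a, 'm, 'g) graded_module = "('a, 'm) module" +
  component :: "'g \<Rightarrow> 'm set"

text \<open>
  A monomial ideal as a multigraded module: the component of degree \<open>a\<close> consists of the scalar
  multiples of the monomial with exponent \<open>a\<close> that lie in the ideal; it is zero if \<open>a\<close> has a
  negative entry.
\<close>

definition ideal_module ::
    "('v, 'k::field) mpoly set \<Rightarrow> (('v, 'k) mpoly, ('v, 'k) mpoly, 'v \<Rightarrow> int) graded_module"
  where "ideal_module I =
    \<lparr>carrier = I, monoid.mult = (*), one = 1, ring.zero = 0, add = (+), module.smult = (*),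
     component = (\<lambda>a. {p \<in> I. \<forall>t \<in> Poly_Mapping.keys p. \<forall>v. int (Poly_Mapping.lookup t v) = a v})\<rparr>"

definition quotient_module ::
    "('a, 'm, 'g) graded_module \<Rightarrow> 'm set \<Rightarrow> ('a, 'm set, 'g) graded_module"
  where "quotient_module M N =
    \<lparr>carrier = a_rcosets\<^bsub>M\<^esub> N, monoid.mult = rcoset_mult M N, one = N +>\<^bsub>M\<^esub> \<one>\<^bsub>M\<^esub>,
     ring.zero = N, add = set_add M, module.smult = (\<lambda>r A. \<Union>x\<in>A. N +>\<^bsub>M\<^esub> (r \<odot>\<^bsub>M\<^esub> x)),
     component = (\<lambda>a. (\<lambda>x. N +>\<^bsub>M\<^esub> x) ` component M a)\<rparr>"

definition homogeneous :: "('a, 'm, 'g) graded_module \<Rightarrow> 'm \<Rightarrow> bool"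
  where "homogeneous M m \<longleftrightarrow> (\<exists>a. m \<in> component M a)"

definition stanley_space ::
    "(('v, 'k::field) mpoly, 'm, 'v \<Rightarrow> int) graded_module \<Rightarrow> 'm \<Rightarrow> 'v set \<Rightarrow> 'm set"
  where "stanley_space M m Z = (\<lambda>u. u \<odot>\<^bsub>M\<^esub> m) ` polynomials_in Z"

text \<open>
  A list of pairs \<open>(m, Z)\<close> stands for the family of the spaces \<open>m K[Z]\<close>. Injectivity of
  \<open>u \<mapsto> u m\<close> on \<open>K[Z]\<close> says that \<open>m K[Z]\<close> is free over \<open>K[Z]\<close> with basis \<open>m\<close>; the last
  conjunct says that \<open>M\<close> is the direct sum of these spaces. Since every \<open>m\<close> is homogeneous, this
  is a decomposition of graded vector spaces.
\<close>

definition stanley_decomposition ::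
    "(('v, 'k::field) mpoly, 'm, 'v \<Rightarrow> int) graded_module \<Rightarrow> ('m \<times> 'v set) list \<Rightarrow> bool"
  where "stanley_decomposition M D \<longleftrightarrow>
    (\<forall>(m, Z) \<in> set D. homogeneous M m \<and> inj_on (\<lambda>u. u \<odot>\<^bsub>M\<^esub> m) (polynomials_in Z)) \<and>
    (\<forall>x \<in> carrier M. \<exists>!y.
       y \<in> (\<Pi>\<^sub>E i \<in> {..<length D}. stanley_space M (fst (D ! i)) (snd (D ! i))) \<and>
       x = (\<Oplus>\<^bsub>M\<^esub>i \<in> {..<length D}. y i))"

text \<open>
  The maximum is taken over a subset of \<open>{0..CARD('v)}\<close> if \<open>M\<close> is nonzero; for \<open>M = 0\<close> the
  only decomposition is the empty one and the value is unspecified.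
\<close>

definition sdepth :: "(('v::finite, 'k::field) mpoly, 'm, 'v \<Rightarrow> int) graded_module \<Rightarrow> nat"
  where "sdepth M = Max {Min (card ` snd ` set D) | D. stanley_decomposition M D}"

end

theory Submission
  imports Defs
begin

text \<open>
  Let the minimal generators of \<open>J\<close> be \<open>m\<close> monomials; regularity of the
  sequence forces their supports to be disjoint. A monomial \<open>t\<close> lies in \<open>J\<^sup>n\<close> iff its weight, the sum
  over \<open>j\<close> of the largest \<open>k\<close> such that \<open>t\<close> is divisible by the \<open>k\<close>-th power of the \<open>j\<close>-th
  generator, is at least \<open>n\<close>. Fixing one variable in each
  support partitions the monomials of weight less than \<open>n\<close> into cones of dimension \<open>CARD('v) - m\<close>; for
  weight at least \<open>n\<close> one may stop before the last support and gains one dimension. In the quotients no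
  larger cone is possible, since it would contain a power of a generator. In \<open>J\<^sup>n\<close>, comparing the
  numbers of minimal generators of \<open>J\<^sup>n\<close> and of the next power excludes larger cones for \<open>m \<le> n + 1\<close>.
  The Krull dimension is at most \<open>CARD('v) - m\<close> because a prime containing \<open>J\<close> contains a variable from
  each support, and because elements separating the members of a chain of primes are algebraically
  independent modulo the smallest one.
\<close>

section \<open>Polynomials supported on a set of exponents\<close>

text \<open>Why one fixed variable per support suffices: if \<open>ord j t = k\<close>, some
  variable of the support prevents the power \<open>k + 1\<close>, and the first such variable in a
  fixed enumeration is a canonical choice. Earlier variables must then admit the power
  \<open>k + 1\<close> and later ones the power \<open>k\<close>. All these are lower bounds, which
  a cone can express once the exponent of the chosen variable is frozen. For weight at least
  \<open>n\<close>, the support at which the partial sum of orders reaches \<open>n\<close>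
  contributes only a lower bound, so at most \<open>m - 1\<close> variables are frozen.

  The restriction \<open>m \<le> n + 1\<close> comes from counting: from the \<open>n\<close>-th
  power to the next the number of minimal generators grows by the factor
  \<open>(n + m) / (n + 1)\<close>, which is below 2 exactly in this range, while too large cones
  would force a factor of at least 2.

  That the Krull dimension is at least \<open>CARD('v) - m\<close> is shown by primes generated by
  variables: one variable from each support, then the remaining variables adjoined one at a
  time.\<close>

lemma carrier_polynomial_ring [simp]: "carrier polynomial_ring = UNIV"
  and mult_polynomial_ring [simp]: "p \<otimes>\<^bsub>polynomial_ring\<^esub> q = p * q"
  and add_polynomial_ring [simp]: "p \<oplus>\<^bsub>polynomial_ring\<^esub> q = p + q"
  and one_polynomial_ring [simp]: "\<one>\<^bsub>polynomial_ring\<^esub> = 1"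
  and zero_polynomial_ring [simp]: "\<zero>\<^bsub>polynomial_ring\<^esub> = 0"
  by (simp_all add: ring_of_type_algebra_def)

lemma poly_mapping_eq_sum_single:
  "p = (\<Sum>t\<in>Poly_Mapping.keys p. Poly_Mapping.single t (Poly_Mapping.lookup p t))"
  by (rule poly_mapping_eqI)
    (simp add: lookup_sum lookup_single when_def sum.delta' in_keys_iff)

lemma lookup_times_eq_sum:
  fixes p q :: "('v, 'k::field) mpoly"
  shows "Poly_Mapping.lookup (p * q) t =
    (\<Sum>a\<in>Poly_Mapping.keys p. \<Sum>b\<in>Poly_Mapping.keys q.
       if a + b = t then Poly_Mapping.lookup p a * Poly_Mapping.lookup q b else 0)"
proof -
  have "p * q = (\<Sum>a\<in>Poly_Mapping.keys p. \<Sum>b\<in>Poly_Mapping.keys q.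
      Poly_Mapping.single (a + b) (Poly_Mapping.lookup p a * Poly_Mapping.lookup q b))"
    by (subst poly_mapping_eq_sum_single[of p], subst poly_mapping_eq_sum_single[of q])
      (simp add: sum_product mult_single)
  then show ?thesis
    by (simp add: lookup_sum lookup_single when_def)
qed

lemma keys_monomial [simp]: "Poly_Mapping.keys (monomial a :: ('v, 'k::field) mpoly) = {a}"
  by (simp add: monomial_def)

lemma lookup_monomial_same [simp]: "Poly_Mapping.lookup (monomial a :: ('v, 'k::field) mpoly) a = 1"
  by (simp add: monomial_def)

lemma lookup_times_monomial:
  fixes p :: "('v, 'k::field) mpoly"
  shows "Poly_Mapping.lookup (p * monomial a) (b + a) = Poly_Mapping.lookup p b"
  unfolding lookup_times_eq_sum keys_monomial by (auto simp: in_keys_iff)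

lemma keys_times_monomial:
  fixes p :: "('v, 'k::field) mpoly"
  shows "Poly_Mapping.keys (p * monomial a) = (\<lambda>b. b + a) ` Poly_Mapping.keys p"
proof
  show "Poly_Mapping.keys (p * monomial a) \<subseteq> (\<lambda>b. b + a) ` Poly_Mapping.keys p"
    using keys_mult[of p "monomial a"] by (auto simp: monomial_def)
  show "(\<lambda>b. b + a) ` Poly_Mapping.keys p \<subseteq> Poly_Mapping.keys (p * monomial a)"
    by (auto simp: in_keys_iff lookup_times_monomial)
qed

lemma monomial_neq_0 [simp]: "(monomial a :: ('v, 'k::field) mpoly) \<noteq> 0"
  by (metis keys_eq_empty keys_monomial insert_not_empty)

lemma monomial_add: "monomial (a + b) = monomial a * (monomial b :: ('v, 'k::field) mpoly)"
  by (simp add: monomial_def mult_single)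

lemma times_monomial_cancel:
  fixes p q :: "('v, 'k::field) mpoly"
  shows "p * monomial a = q * monomial a \<longleftrightarrow> p = q"
  by (metis lookup_times_monomial poly_mapping_eqI)

lemma exponent_le_iff:
  fixes a b :: "'v \<Rightarrow>\<^sub>0 nat"
  shows "(\<exists>s. b = a + s) \<longleftrightarrow> (\<forall>v. Poly_Mapping.lookup a v \<le> Poly_Mapping.lookup b v)"
proof
  assume "\<forall>v. Poly_Mapping.lookup a v \<le> Poly_Mapping.lookup b v"
  then have "b = a + (b - a)"
    by (intro poly_mapping_eqI) (simp add: lookup_add lookup_minus)
  then show "\<exists>s. b = a + s" by blast
qed (auto simp: lookup_add)

text \<open>For an upward closed set this is a monomial ideal, so ideals and their quotients can be
  handled through sets of exponents and differences of such sets.\<close>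

definition polys_on :: "('v \<Rightarrow>\<^sub>0 nat) set \<Rightarrow> ('v, 'k::field) mpoly set"
  where "polys_on A = {p. Poly_Mapping.keys p \<subseteq> A}"

lemma polys_on_0 [simp]: "0 \<in> polys_on A"
  and polys_on_monomial [simp]: "monomial t \<in> polys_on A \<longleftrightarrow> t \<in> A"
  and polys_on_UNIV [simp]: "polys_on UNIV = UNIV"
  and polys_on_empty [simp]: "polys_on {} = {0}"
  by (auto simp: polys_on_def)

lemma polys_on_add: "p \<in> polys_on A \<Longrightarrow> q \<in> polys_on A \<Longrightarrow> p + q \<in> polys_on A"
  unfolding polys_on_def using keys_add[of p q] by blast

lemma polys_on_uminus: "p \<in> polys_on A \<Longrightarrow> - p \<in> polys_on A"
  unfolding polys_on_def by (auto simp: in_keys_iff)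

lemma polys_on_diff: "p \<in> polys_on A \<Longrightarrow> q \<in> polys_on A \<Longrightarrow> p - q \<in> polys_on A"
  using polys_on_add[OF _ polys_on_uminus, of p A q] by simp

lemma polys_on_sum: "(\<And>i. i \<in> I \<Longrightarrow> p i \<in> polys_on A) \<Longrightarrow> sum p I \<in> polys_on A"
  by (induction I rule: infinite_finite_induct) (auto intro: polys_on_add)

lemma polys_on_mono: "A \<subseteq> B \<Longrightarrow> polys_on A \<subseteq> polys_on B"
  by (auto simp: polys_on_def)

section \<open>Monomial ideals and upward closed sets of exponents\<close>

definition up_closed :: "('v \<Rightarrow>\<^sub>0 nat) set \<Rightarrow> bool"
  where "up_closed A \<longleftrightarrow> (\<forall>t\<in>A. \<forall>s. t + s \<in> A)"

definition up_closure :: "('v \<Rightarrow>\<^sub>0 nat) set \<Rightarrow> ('v \<Rightarrow>\<^sub>0 nat) set"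
  where "up_closure T = {t + s | t s. t \<in> T}"

lemma up_closed_up_closure: "up_closed (up_closure T)"
  unfolding up_closed_def up_closure_def using add.assoc by blast

lemma polys_on_mult_left:
  assumes "up_closed A" "p \<in> polys_on A"
  shows "r * p \<in> polys_on A"
  using keys_mult[of r p] assms unfolding polys_on_def up_closed_def
  by (fastforce simp: add.commute)

lemma cring_polynomial_ring: "cring (polynomial_ring :: ('v, 'k::field) mpoly ring)"
  by (rule cring_from_type_algebra)

lemma ring_polynomial_ring: "ring (polynomial_ring :: ('v, 'k::field) mpoly ring)"
  by (rule ring_from_type_algebra)

lemma a_inv_polynomial_ring [simp]: "\<ominus>\<^bsub>polynomial_ring\<^esub> p = - (p :: ('v, 'k::field) mpoly)"
proof -
  interpret ring "polynomial_ring :: ('v, 'k) mpoly ring"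
    by (rule ring_polynomial_ring)
  show ?thesis
    by (rule minus_equality) auto
qed

text \<open>Negatives are multiples by \<open>-1\<close> and multiplication is commutative, so three
  closure conditions suffice.\<close>

lemma ideal_polynomial_ring_iff:
  fixes I :: "('v, 'k::field) mpoly set"
  shows "ideal I polynomial_ring \<longleftrightarrow>
    0 \<in> I \<and> (\<forall>p\<in>I. \<forall>q\<in>I. p + q \<in> I) \<and> (\<forall>p\<in>I. \<forall>r. r * p \<in> I)"
proof (intro iffI conjI ballI allI)
  assume "ideal I polynomial_ring"
  then interpret ideal I "polynomial_ring :: ('v, 'k) mpoly ring" .
  show "0 \<in> I" using additive_subgroup.zero_closed[OF additive_subgroup_axioms] by simp
  show "p + q \<in> I" if "p \<in> I" "q \<in> I" for p q using additive_subgroup.a_closed[OF additive_subgroup_axioms that] by simp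
  show "r * p \<in> I" if "p \<in> I" for p r using I_l_closed[OF that, of r] by simp
next
  assume I: "0 \<in> I \<and> (\<forall>p\<in>I. \<forall>q\<in>I. p + q \<in> I) \<and> (\<forall>p\<in>I. \<forall>r. r * p \<in> I)"
  have neg: "- p \<in> I" if "p \<in> I" for p
    using I that by (metis mult_minus1)
  interpret ring "polynomial_ring :: ('v, 'k) mpoly ring"
    by (rule ring_polynomial_ring)
  show "ideal I polynomial_ring"
  proof (rule idealI)
    show "subgroup I (add_monoid polynomial_ring)"
    proof (rule add.subgroupI)
      fix p assume "p \<in> I"
      then show "\<ominus>\<^bsub>polynomial_ring\<^esub> p \<in> I"
        using neg by simp
    qed (use I in auto)
    show "x \<otimes>\<^bsub>polynomial_ring\<^esub> a \<in> I" if "a \<in> I" for a x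
      using I that by simp
    show "a \<otimes>\<^bsub>polynomial_ring\<^esub> x \<in> I" if "a \<in> I" for a x
      using I that by (simp add: mult.commute[of a])
  qed (rule ring_polynomial_ring)
qed

lemma ideal_polys_on: "up_closed A \<Longrightarrow> ideal (polys_on A :: ('v, 'k::field) mpoly set) polynomial_ring"
  by (simp add: ideal_polynomial_ring_iff polys_on_add polys_on_mult_left)

text \<open>Each term of \<open>p\<close> is a constant times its monomial, and an ideal absorbs
  constants.\<close>

lemma mem_ideal_if_monomials:
  fixes I :: "('v, 'k::field) mpoly set"
  assumes I: "ideal I polynomial_ring" and "\<And>t. t \<in> Poly_Mapping.keys p \<Longrightarrow> monomial t \<in> I"
  shows "p \<in> I"
proof -
  have mul: "r * q \<in> I" if "q \<in> I" for r q
    using I that by (simp add: ideal_polynomial_ring_iff)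
  have "(\<Sum>t\<in>F. Poly_Mapping.single t (Poly_Mapping.lookup p t)) \<in> I"
    if "finite F" "F \<subseteq> Poly_Mapping.keys p" for F
    using that
  proof (induction F rule: finite_induct)
    case (insert t F)
    have "Poly_Mapping.single t (Poly_Mapping.lookup p t) =
        Poly_Mapping.single 0 (Poly_Mapping.lookup p t) * monomial t"
      by (simp add: monomial_def mult_single)
    then show ?case
      using insert I mul[OF assms(2)[of t]] by (auto simp: ideal_polynomial_ring_iff)
  qed (use I in \<open>simp add: ideal_polynomial_ring_iff\<close>)
  then show ?thesis
    by (subst poly_mapping_eq_sum_single) simp
qed

lemma genideal_monomials:
  "Idl\<^bsub>polynomial_ring\<^esub> (monomial ` T) = (polys_on (up_closure T) :: ('v, 'k::field) mpoly set)"
proof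
  interpret ring "polynomial_ring :: ('v, 'k) mpoly ring"
    by (rule ring_polynomial_ring)
  have "monomial ` T \<subseteq> (polys_on (up_closure T) :: ('v, 'k) mpoly set)"
    by (auto simp: up_closure_def) (metis add.right_neutral)
  then show "Idl\<^bsub>polynomial_ring\<^esub> (monomial ` T) \<subseteq> (polys_on (up_closure T) :: ('v, 'k) mpoly set)"
    by (intro genideal_minimal ideal_polys_on up_closed_up_closure)
  show "polys_on (up_closure T) \<subseteq> Idl\<^bsub>polynomial_ring\<^esub> (monomial ` T :: ('v, 'k) mpoly set)"
  proof
    fix p :: "('v, 'k) mpoly"
    assume p: "p \<in> polys_on (up_closure T)"
    have I: "ideal (Idl\<^bsub>polynomial_ring\<^esub> (monomial ` T)) (polynomial_ring :: ('v, 'k) mpoly ring)"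
      by (rule genideal_ideal) simp
    show "p \<in> Idl\<^bsub>polynomial_ring\<^esub> (monomial ` T)"
    proof (rule mem_ideal_if_monomials[OF I])
      fix t assume "t \<in> Poly_Mapping.keys p"
      then obtain a s where t: "t = a + s" "a \<in> T"
        using p by (auto simp: polys_on_def up_closure_def)
      have "monomial a \<in> Idl\<^bsub>polynomial_ring\<^esub> (monomial ` T :: ('v, 'k) mpoly set)"
        using genideal_self[of "monomial ` T"] t(2) by auto
      then have "monomial s * monomial a \<in> Idl\<^bsub>polynomial_ring\<^esub> (monomial ` T :: ('v, 'k) mpoly set)"
        using I by (simp add: ideal_polynomial_ring_iff)
      then show "(monomial t :: ('v, 'k) mpoly) \<in> Idl\<^bsub>polynomial_ring\<^esub> (monomial ` T)"
        by (simp add: t monomial_add mult.commute)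
    qed
  qed
qed

text \<open>The linear projection that forgets all monomials outside \<open>A\<close>. It reads off
  the components in a Stanley decomposition, and it also serves to set the variables outside a given
  set to zero.\<close>

definition restrict_poly :: "('v \<Rightarrow>\<^sub>0 nat) set \<Rightarrow> ('v, 'k::field) mpoly \<Rightarrow> ('v, 'k) mpoly"
  where "restrict_poly A p =
    (\<Sum>t\<in>Poly_Mapping.keys p \<inter> A. Poly_Mapping.single t (Poly_Mapping.lookup p t))"

lemma lookup_restrict_poly:
  "Poly_Mapping.lookup (restrict_poly A p) t = (if t \<in> A then Poly_Mapping.lookup p t else 0)"
  by (auto simp: restrict_poly_def lookup_sum lookup_single when_def sum.delta' in_keys_iff)

lemma restrict_poly_in_polys_on: "restrict_poly A p \<in> polys_on A"
  by (auto simp: polys_on_def in_keys_iff lookup_restrict_poly split: if_splits)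

lemma restrict_poly_diff: "restrict_poly A (p - q) = restrict_poly A p - restrict_poly A q"
  by (rule poly_mapping_eqI) (simp add: lookup_restrict_poly lookup_minus)

lemma restrict_poly_sum: "restrict_poly A (sum p I) = (\<Sum>i\<in>I. restrict_poly A (p i))"
  by (rule poly_mapping_eqI) (simp add: lookup_restrict_poly lookup_sum)

lemma restrict_poly_id: "p \<in> polys_on A \<Longrightarrow> restrict_poly A p = p"
  by (rule poly_mapping_eqI) (auto simp: lookup_restrict_poly polys_on_def in_keys_iff)

lemma restrict_poly_disjoint: "p \<in> polys_on B \<Longrightarrow> A \<inter> B = {} \<Longrightarrow> restrict_poly A p = 0"
  by (rule poly_mapping_eqI) (auto simp: lookup_restrict_poly polys_on_def in_keys_iff)

section \<open>Stanley decompositions of monomial modules\<close>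

definition cone :: "('v \<Rightarrow>\<^sub>0 nat) \<Rightarrow> 'v set \<Rightarrow> ('v \<Rightarrow>\<^sub>0 nat) set"
  where "cone a Z = {b + a | b. Poly_Mapping.keys b \<subseteq> Z}"

lemma apex_in_cone: "a \<in> cone a Z"
  unfolding cone_def using add_0_left[of a] keys_zero by (metis (mono_tags, lifting) empty_subsetI mem_Collect_eq)

lemma polynomials_in_times_monomial:
  "(\<lambda>r. r * monomial a) ` polynomials_in Z = (polys_on (cone a Z) :: ('v, 'k::field) mpoly set)"
proof
  show "(\<lambda>r. r * monomial a) ` polynomials_in Z \<subseteq> (polys_on (cone a Z) :: ('v, 'k) mpoly set)"
    by (auto simp: polys_on_def keys_times_monomial polynomials_in_def cone_def)
  show "(polys_on (cone a Z) :: ('v, 'k) mpoly set) \<subseteq> (\<lambda>r. r * monomial a) ` polynomials_in Z"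
  proof
    fix p :: "('v, 'k) mpoly"
    assume "p \<in> polys_on (cone a Z)"
    then have p: "Poly_Mapping.keys p \<subseteq> cone a Z" by (simp add: polys_on_def)
    \<comment> \<open>Termwise division by \<open>monomial a\<close>. The truncated subtraction is
      exact because every exponent of \<open>p\<close> lies in the cone.\<close>
    define q where "q = (\<Sum>t\<in>Poly_Mapping.keys p. Poly_Mapping.single (t - a) (Poly_Mapping.lookup p t))"
    have eq: "t - a + a = t" "Poly_Mapping.keys (t - a) \<subseteq> Z" if "t \<in> Poly_Mapping.keys p" for t
    proof -
      obtain b where "t = b + a" "Poly_Mapping.keys b \<subseteq> Z"
        using subsetD[OF p \<open>t \<in> Poly_Mapping.keys p\<close>] unfolding cone_def by blast
      then show "t - a + a = t" "Poly_Mapping.keys (t - a) \<subseteq> Z" by simp_all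
    qed
    have "q * monomial a = (\<Sum>t\<in>Poly_Mapping.keys p. Poly_Mapping.single t (Poly_Mapping.lookup p t))"
      by (simp add: q_def sum_distrib_right monomial_def mult_single eq)
    also have "\<dots> = p"
      by (rule poly_mapping_eq_sum_single[symmetric])
    finally have "p = q * monomial a" by simp
    moreover have "q \<in> polynomials_in Z"
    proof -
      have "Poly_Mapping.keys t \<subseteq> Z" if "t \<in> Poly_Mapping.keys q" for t
        using that keys_times_monomial[of q a] \<open>p = q * monomial a\<close> eq(2)[of "t + a"] by auto
      then show ?thesis by (simp add: polynomials_in_def)
    qed
    ultimately show "p \<in> (\<lambda>r. r * monomial a) ` polynomials_in Z" by blast
  qed
qed

definition component_polys :: "('v, 'k::field) mpoly set \<Rightarrow> ('v \<Rightarrow> int) \<Rightarrow> ('v, 'k) mpoly set"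
  where "component_polys I a =
    {p \<in> I. \<forall>t \<in> Poly_Mapping.keys p. \<forall>v. int (Poly_Mapping.lookup t v) = a v}"

text \<open>Abstracts the common features of an ideal (\<open>A' = {}\<close>) and of a quotient of two ideals.\<close>

locale monomial_module =
  fixes M :: "(('v::finite, 'k::field) mpoly, 'm, 'v \<Rightarrow> int) graded_module" (structure)
    and \<phi> :: "('v, 'k) mpoly \<Rightarrow> 'm"
    and A A' :: "('v \<Rightarrow>\<^sub>0 nat) set"
  assumes carrier_eq: "carrier M = \<phi> ` polys_on A"
    and phi_add: "p \<in> polys_on A \<Longrightarrow> q \<in> polys_on A \<Longrightarrow> \<phi> (p + q) = \<phi> p \<oplus>\<^bsub>M\<^esub> \<phi> q"
    and phi_0: "\<phi> 0 = \<zero>\<^bsub>M\<^esub>"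
    and phi_smult: "p \<in> polys_on A \<Longrightarrow> \<phi> (r * p) = r \<odot>\<^bsub>M\<^esub> \<phi> p"
    and phi_eq_iff: "p \<in> polys_on A \<Longrightarrow> q \<in> polys_on A \<Longrightarrow> \<phi> p = \<phi> q \<longleftrightarrow> p - q \<in> polys_on A'"
    and component_eq: "component M a = \<phi> ` component_polys (polys_on A) a"
    and up_closed_A: "up_closed A"
    and nontrivial: "A - A' \<noteq> {}"
begin

lemma abelian_monoid_M: "abelian_monoid M"
proof (rule abelian_monoidI)
  show "x \<oplus> y \<in> carrier M" if "x \<in> carrier M" "y \<in> carrier M" for x y
    using that by (auto simp: carrier_eq simp flip: phi_add intro: polys_on_add)
  show "x \<oplus> y \<oplus> z = x \<oplus> (y \<oplus> z)" if "x \<in> carrier M" "y \<in> carrier M" "z \<in> carrier M" for x y z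
    using that by (auto simp: carrier_eq polys_on_add add.assoc simp flip: phi_add)
  show "x \<oplus> y = y \<oplus> x" if "x \<in> carrier M" "y \<in> carrier M" for x y
    using that by (auto simp: carrier_eq add.commute simp flip: phi_add)
  show "\<zero> \<oplus> x = x" if "x \<in> carrier M" for x
    using that by (auto simp: carrier_eq simp flip: phi_add phi_0)
  show "\<zero> \<in> carrier M"
    by (simp add: carrier_eq flip: phi_0)
qed

sublocale abelian_monoid M by (rule abelian_monoid_M)

lemma finsum_phi:
  assumes "finite F" "\<And>i. i \<in> F \<Longrightarrow> q i \<in> polys_on A" "\<And>i. i \<in> F \<Longrightarrow> y i = \<phi> (q i)"
  shows "(\<Oplus>\<^bsub>M\<^esub>i\<in>F. y i) = \<phi> (\<Sum>i\<in>F. q i)"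
  using assms
proof (induction F rule: finite_induct)
  case (insert i F)
  have "y j \<in> carrier M" if "j \<in> insert i F" for j
    using insert.prems that by (auto simp: carrier_eq)
  then have "(\<Oplus>\<^bsub>M\<^esub>j\<in>insert i F. y j) = y i \<oplus> (\<Oplus>\<^bsub>M\<^esub>j\<in>F. y j)"
    using insert.hyps by (intro finsum_insert) auto
  also have "\<dots> = \<phi> (q i + (\<Sum>j\<in>F. q j))"
    using insert by (subst phi_add) (auto intro!: polys_on_sum)
  finally show ?case using insert.hyps by simp
qed (simp add: phi_0)

lemma stanley_space_monomial:
  assumes "a \<in> A"
  shows "stanley_space M (\<phi> (monomial a)) Z = \<phi> ` polys_on (cone a Z)"
  using assms by (simp add: stanley_space_def image_image flip: polynomials_in_times_monomial phi_smult)

lemma homogeneous_phi_monomial: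
  assumes "a \<in> A"
  shows "homogeneous M (\<phi> (monomial a))"
  unfolding homogeneous_def component_eq component_polys_def
  using assms by (intro exI[of _ "\<lambda>v. int (Poly_Mapping.lookup a v)"] image_eqI[OF refl]) auto

text \<open>The difference of two multiples with the same image has its exponents in
  \<open>A'\<close> and also in the cone, which avoids \<open>A'\<close>; so it vanishes.\<close>

lemma inj_on_cone:
  assumes sub: "cone a Z \<subseteq> A - A'"
  shows "inj_on (\<lambda>r. r \<odot>\<^bsub>M\<^esub> \<phi> (monomial a)) (polynomials_in Z)"
proof (rule inj_onI)
  fix r r' :: "('v, 'k) mpoly"
  assume r: "r \<in> polynomials_in Z" "r' \<in> polynomials_in Z"
    and eq: "r \<odot>\<^bsub>M\<^esub> \<phi> (monomial a) = r' \<odot>\<^bsub>M\<^esub> \<phi> (monomial a)"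
  have a: "a \<in> A" using sub apex_in_cone by blast
  have on: "x * monomial a \<in> polys_on (cone a Z)" if "x \<in> polynomials_in Z" for x :: "('v, 'k) mpoly"
    using that polynomials_in_times_monomial by blast
  have onA: "x * monomial a \<in> polys_on A" if "x \<in> polynomials_in Z" for x :: "('v, 'k) mpoly"
    using on[OF that] sub by (auto simp: polys_on_def)
  have "\<phi> (r * monomial a) = \<phi> (r' * monomial a)"
    using eq a by (simp add: phi_smult)
  then have "r * monomial a - r' * monomial a \<in> polys_on A'"
    using phi_eq_iff onA r by blast
  moreover have "r * monomial a - r' * monomial a \<in> polys_on (cone a Z)"
    using on r by (intro polys_on_diff)
  ultimately have "Poly_Mapping.keys (r * monomial a - r' * monomial a) = {}"
    using sub unfolding polys_on_def by blast
  then show "r = r'" by (simp add: times_monomial_cancel)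
qed

text \<open>Components exist by restricting a representative to each cone. They are unique because
  restriction to one cone kills polynomials on the other cones and on \<open>A'\<close>, hence does
  not depend on the representative.\<close>

lemma stanley_decomposition_of_partition:
  fixes as :: "(('v \<Rightarrow>\<^sub>0 nat) \<times> 'v set) list"
  defines "C \<equiv> \<lambda>i. cone (fst (as ! i)) (snd (as ! i))"
  assumes sub: "\<And>i. i < length as \<Longrightarrow> C i \<subseteq> A - A'"
    and disj: "\<And>i j. i < length as \<Longrightarrow> j < length as \<Longrightarrow> i \<noteq> j \<Longrightarrow> C i \<inter> C j = {}"
    and cover: "A - A' \<subseteq> (\<Union>i<length as. C i)"
  shows "stanley_decomposition M (map (\<lambda>(a, Z). (\<phi> (monomial a), Z)) as)"
proof -
  let ?D = "map (\<lambda>(a, Z). (\<phi> (monomial a), Z)) as"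
  let ?l = "length as"
  have apex: "fst (as ! i) \<in> A" if "i < ?l" for i
    using sub[OF that] apex_in_cone by (auto simp: C_def)
  have space: "stanley_space M (fst (?D ! i)) (snd (?D ! i)) = \<phi> ` polys_on (C i)" if "i < ?l" for i
    using that apex[OF that] by (simp add: split_beta stanley_space_monomial C_def)
  have CA: "q \<in> polys_on A" if "q \<in> polys_on (C i)" "i < ?l" for i and q :: "('v, 'k) mpoly"
    using that sub[of i] by (auto simp: polys_on_def)
  show ?thesis
    unfolding stanley_decomposition_def
  proof (intro conjI ballI)
    fix x assume "x \<in> set ?D"
    then obtain i where i: "i < ?l" "x = (\<phi> (monomial (fst (as ! i))), snd (as ! i))"
      by (auto simp: in_set_conv_nth split_beta)
    then show "case x of (m, Z) \<Rightarrow> homogeneous M m \<and> inj_on (\<lambda>u. u \<odot>\<^bsub>M\<^esub> m) (polynomials_in Z)"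
      using homogeneous_phi_monomial[OF apex] inj_on_cone[OF sub[OF i(1), unfolded C_def]] by auto
  next
    fix x assume "x \<in> carrier M"
    then obtain p where p: "p \<in> polys_on A" "x = \<phi> p" by (auto simp: carrier_eq)
    let ?S = "\<Pi>\<^sub>E i\<in>{..<length ?D}. stanley_space M (fst (?D ! i)) (snd (?D ! i))"
    have mem_S: "y \<in> ?S \<longleftrightarrow> y \<in> (\<Pi>\<^sub>E i\<in>{..<?l}. \<phi> ` polys_on (C i))" for y
      using space unfolding PiE_iff by (auto simp del: nth_map)
    define y where "y = restrict (\<lambda>i. \<phi> (restrict_poly (C i) p)) {..<?l}"
    have yS: "y \<in> ?S"
      unfolding mem_S by (auto simp: y_def restrict_poly_in_polys_on)
    have "(\<Oplus>\<^bsub>M\<^esub>i\<in>{..<?l}. y i) = \<phi> (\<Sum>i<?l. restrict_poly (C i) p)"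
      by (rule finsum_phi) (auto simp: y_def intro: CA restrict_poly_in_polys_on)
    also have "\<dots> = \<phi> p"
    proof (subst phi_eq_iff)
      show "(\<Sum>i<?l. restrict_poly (C i) p) \<in> polys_on A"
        by (auto intro!: polys_on_sum CA restrict_poly_in_polys_on)
      \<comment> \<open>An exponent in \<open>A\<close> but not in \<open>A'\<close> lies in exactly
        one cone, and outside \<open>A\<close> both polynomials vanish; the discrepancy is confined
        to \<open>A'\<close>.\<close>
      show "(\<Sum>i<?l. restrict_poly (C i) p) - p \<in> polys_on A'"
        unfolding polys_on_def
      proof (intro CollectI subsetI, rule ccontr)
        fix t assume t: "t \<in> Poly_Mapping.keys ((\<Sum>i<?l. restrict_poly (C i) p) - p)" "t \<notin> A'"
        show False
        proof (cases "t \<in> A")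
          case True
          then obtain i where i: "i < ?l" "t \<in> C i" using cover t(2) by blast
          have "(\<Sum>j<?l. Poly_Mapping.lookup (restrict_poly (C j) p) t) =
              (\<Sum>j<?l. if j = i then Poly_Mapping.lookup p t else 0)"
            using i disj by (intro sum.cong refl) (auto simp: lookup_restrict_poly)
          then show False
            using t(1) i(1) by (simp add: in_keys_iff lookup_minus lookup_sum)
        next
          case False
          then have "Poly_Mapping.lookup (restrict_poly (C j) p) t = 0" if "j < ?l" for j
            using sub[OF that] by (auto simp: lookup_restrict_poly)
          moreover have "Poly_Mapping.lookup p t = 0"
            using False p(1) by (auto simp: polys_on_def in_keys_iff)
          ultimately show False
            using t(1) by (simp add: in_keys_iff lookup_minus lookup_sum)
        qed
      qed
    qed (use p in auto)
    finally have ysum: "x = (\<Oplus>\<^bsub>M\<^esub>i\<in>{..<length ?D}. y i)" using p by simp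
    show "\<exists>!y. y \<in> ?S \<and> x = (\<Oplus>\<^bsub>M\<^esub>i\<in>{..<length ?D}. y i)"
    proof (rule ex1I[of _ y])
      show "y \<in> ?S \<and> x = (\<Oplus>\<^bsub>M\<^esub>i\<in>{..<length ?D}. y i)"
        using yS ysum by blast
    next
      fix z assume z: "z \<in> ?S \<and> x = (\<Oplus>\<^bsub>M\<^esub>i\<in>{..<length ?D}. z i)"
      then have "\<forall>i<?l. \<exists>q. q \<in> polys_on (C i) \<and> z i = \<phi> q"
        unfolding mem_S by (auto simp: PiE_iff)
      then obtain q where q: "\<And>i. i < ?l \<Longrightarrow> q i \<in> polys_on (C i)" "\<And>i. i < ?l \<Longrightarrow> z i = \<phi> (q i)"
        by metis
      have "\<phi> p = (\<Oplus>\<^bsub>M\<^esub>i\<in>{..<?l}. z i)" using z p by simp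
      also have "\<dots> = \<phi> (\<Sum>i<?l. q i)"
        by (rule finsum_phi) (simp_all add: q CA[OF q(1)])
      finally have diff: "p - (\<Sum>i<?l. q i) \<in> polys_on A'"
        using phi_eq_iff[OF p(1), of "\<Sum>i<?l. q i"] q CA by (auto intro!: polys_on_sum)
      have "z i = y i" if i: "i < ?l" for i
      proof -
        have "restrict_poly (C i) (\<Sum>j<?l. q j) = (\<Sum>j<?l. if j = i then q i else 0)"
          unfolding restrict_poly_sum
        proof (intro sum.cong refl)
          fix j assume j: "j \<in> {..<?l}"
          show "restrict_poly (C i) (q j) = (if j = i then q i else 0)"
          proof (cases "j = i")
            case True
            then show ?thesis using q(1)[of i] i restrict_poly_id by auto
          next
            case False
            then show ?thesis using restrict_poly_disjoint[OF q(1)[of j]] disj[of i j] i j by auto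
          qed
        qed
        then have "restrict_poly (C i) (\<Sum>j<?l. q j) = q i" using i by simp
        moreover have "restrict_poly (C i) (p - (\<Sum>j<?l. q j)) = 0"
          using restrict_poly_disjoint[OF diff] sub[OF i] by blast
        ultimately have "restrict_poly (C i) p = q i" by (simp add: restrict_poly_diff)
        then show ?thesis using q(2) i by (simp add: y_def)
      qed
      then show "z = y"
        using z yS unfolding mem_S by (intro PiE_ext[of z "{..<?l}" "\<lambda>i. \<phi> ` polys_on (C i)" y]) simp_all
    qed
  qed
qed

text \<open>A classifier \<open>\<kappa>\<close> that is constant on each of the cones it assigns defines a partition.\<close>

lemma stanley_decomposition_of_classifier:
  fixes \<kappa> :: "('v \<Rightarrow>\<^sub>0 nat) \<Rightarrow> ('v \<Rightarrow>\<^sub>0 nat) \<times> 'v set"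
  assumes fin: "finite (\<kappa> ` (A - A'))"
    and self: "\<And>t. t \<in> A - A' \<Longrightarrow> t \<in> cone (fst (\<kappa> t)) (snd (\<kappa> t))"
    and const: "\<And>t t'. t \<in> A - A' \<Longrightarrow> t' \<in> cone (fst (\<kappa> t)) (snd (\<kappa> t)) \<Longrightarrow>
      t' \<in> A - A' \<and> \<kappa> t' = \<kappa> t"
  shows "\<exists>D. stanley_decomposition M D \<and> snd ` set D = snd ` \<kappa> ` (A - A')"
proof -
  obtain as where as: "set as = \<kappa> ` (A - A')" "distinct as"
    using finite_distinct_list[OF fin] by blast
  have ex: "\<exists>t\<in>A - A'. as ! i = \<kappa> t" if "i < length as" for i
    using nth_mem[OF that] unfolding as(1) by blast
  let ?C = "\<lambda>i. cone (fst (as ! i)) (snd (as ! i))"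
  have *: "t \<in> A - A' \<and> \<kappa> t = as ! i" if "i < length as" "t \<in> ?C i" for i t
    using ex[OF that(1)] const that(2) by metis
  have "stanley_decomposition M (map (\<lambda>(a, Z). (\<phi> (monomial a), Z)) as)"
  proof (rule stanley_decomposition_of_partition)
    show "?C i \<subseteq> A - A'" if "i < length as" for i
      using * that by blast
    show "?C i \<inter> ?C j = {}" if "i < length as" "j < length as" "i \<noteq> j" for i j
    proof (rule ccontr)
      assume "?C i \<inter> ?C j \<noteq> {}"
      then obtain t where "t \<in> ?C i" "t \<in> ?C j" by blast
      then have "as ! i = as ! j" using * that by metis
      then show False using that as(2) by (simp add: nth_eq_iff_index_eq)
    qed
    show "A - A' \<subseteq> (\<Union>i<length as. ?C i)"
    proof
      fix t assume t: "t \<in> A - A'"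
      then have "\<kappa> t \<in> set as" using as(1) by blast
      then obtain i where "i < length as" "as ! i = \<kappa> t" by (auto simp: in_set_conv_nth)
      then show "t \<in> (\<Union>i<length as. ?C i)" using self[OF t] by (intro UN_I[of i]) auto
    qed
  qed
  moreover have "snd ` set (map (\<lambda>(a, Z). (\<phi> (monomial a), Z)) as) = snd ` \<kappa> ` (A - A')"
    by (auto simp: as(1)[symmetric] image_image split_beta)
  ultimately show ?thesis by blast
qed

text \<open>The empty sum is zero, but the class of a monomial in \<open>A - A'\<close> is not. The
  upper bound for quotients has to pick some Stanley space.\<close>

lemma stanley_decomposition_nonempty:
  assumes "stanley_decomposition M D"
  shows "D \<noteq> []"
proof
  assume "D = []"
  obtain a where a: "a \<in> A" "a \<notin> A'" using nontrivial by blast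
  have "x = \<zero>" if "x \<in> carrier M" for x
    using assms that \<open>D = []\<close> by (auto simp: stanley_decomposition_def)
  then have "\<phi> (monomial a) = \<phi> 0"
    using a by (simp add: carrier_eq phi_0)
  then show False
    using a phi_eq_iff[of "monomial a" 0] by simp
qed

lemma stanley_decomposition_generator:
  assumes "stanley_decomposition M D" "(m, Z) \<in> set D"
  obtains g a where "g \<in> polys_on A" "m = \<phi> g"
    "\<And>t v. t \<in> Poly_Mapping.keys g \<Longrightarrow> int (Poly_Mapping.lookup t v) = a v"
    "inj_on (\<lambda>r. r \<odot>\<^bsub>M\<^esub> m) (polynomials_in Z)"
proof -
  have "homogeneous M m" and inj: "inj_on (\<lambda>r. r \<odot>\<^bsub>M\<^esub> m) (polynomials_in Z)"
    using assms by (auto simp: stanley_decomposition_def)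
  then obtain a g where "g \<in> component_polys (polys_on A) a" "m = \<phi> g"
    by (auto simp: homogeneous_def component_eq)
  then show thesis using that[of g a] inj by (auto simp: component_polys_def)
qed

text \<open>A monomial that carries \<open>A\<close> into \<open>A'\<close> annihilates the whole
  module, whereas no monomial of \<open>K[Z]\<close> annihilates a free generator.\<close>

lemma stanley_decomposition_annihilator:
  assumes "stanley_decomposition M D" "(m, Z) \<in> set D" "\<And>t. t \<in> A \<Longrightarrow> t + w \<in> A'"
  shows "\<not> Poly_Mapping.keys w \<subseteq> Z"
proof
  assume w: "Poly_Mapping.keys w \<subseteq> Z"
  obtain g where g: "g \<in> polys_on A" "m = \<phi> g" and inj: "inj_on (\<lambda>r. r \<odot>\<^bsub>M\<^esub> m) (polynomials_in Z)"
    using stanley_decomposition_generator[OF assms(1,2)] by metis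
  have on: "monomial w * g \<in> polys_on A" "0 * g \<in> polys_on A"
    using polys_on_mult_left[OF up_closed_A g(1)] by auto
  have "monomial w * g - 0 * g \<in> polys_on A'"
    using g(1) assms(3) keys_times_monomial[of g w] by (auto simp: polys_on_def mult.commute)
  then have "monomial w \<odot>\<^bsub>M\<^esub> m = 0 \<odot>\<^bsub>M\<^esub> m"
    using phi_eq_iff[OF on] g phi_smult[OF g(1), of "monomial w"] phi_smult[OF g(1), of 0] by simp
  then have "monomial w = (0 :: ('v, 'k) mpoly)"
    by (rule inj_onD[OF inj]) (use w in \<open>auto simp: polynomials_in_def\<close>)
  then show False by simp
qed

text \<open>A generator may be any homogeneous element, but one degree contains only scalar
  multiples of a single monomial, whose exponent becomes \<open>b i\<close>. Existence of components
  gives the covering and their uniqueness the disjointness, so upper bounds reduce to questions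
  about cones.\<close>

lemma stanley_decomposition_cones:
  assumes D: "stanley_decomposition M D"
  obtains b where "\<And>i. i < length D \<Longrightarrow> b i \<in> A"
    and "\<And>t. t \<in> A - A' \<Longrightarrow> \<exists>i<length D. t \<in> cone (b i) (snd (D ! i))"
    and "\<And>t i j. t \<in> A - A' \<Longrightarrow> i < length D \<Longrightarrow> j < length D \<Longrightarrow> i \<noteq> j \<Longrightarrow>
      t \<in> cone (b i) (snd (D ! i)) \<Longrightarrow> t \<notin> cone (b j) (snd (D ! j))"
proof -
  let ?l = "length D"
  let ?Z = "\<lambda>i. snd (D ! i)"
  have "\<exists>g b. g \<in> polys_on A \<and> fst (D ! i) = \<phi> g \<and> Poly_Mapping.keys g = {b}" if i: "i < ?l" for i
  proof -
    obtain g a where g: "g \<in> polys_on A" "fst (D ! i) = \<phi> g"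
        "\<And>t v. t \<in> Poly_Mapping.keys g \<Longrightarrow> int (Poly_Mapping.lookup t v) = a v"
        "inj_on (\<lambda>r. r \<odot>\<^bsub>M\<^esub> fst (D ! i)) (polynomials_in (?Z i))"
      using stanley_decomposition_generator[OF D, of "fst (D ! i)" "?Z i"] nth_mem[OF i] by auto
    \<comment> \<open>Freeness excludes a zero generator: otherwise 1 and 0 would have the same
      multiple.\<close>
    have "g \<noteq> 0"
    proof
      assume "g = 0"
      then have "1 \<odot>\<^bsub>M\<^esub> fst (D ! i) = 0 \<odot>\<^bsub>M\<^esub> fst (D ! i)"
        using g(1) phi_smult[OF g(1), of 1] phi_smult[OF g(1), of 0] by (simp add: g(2))
      then have "1 = (0 :: ('v, 'k) mpoly)"
        by (rule inj_onD[OF g(4)]) (auto simp: polynomials_in_def)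
      then show False by simp
    qed
    then obtain b where b: "b \<in> Poly_Mapping.keys g" by (metis all_not_in_conv keys_eq_empty)
    have "t = b" if "t \<in> Poly_Mapping.keys g" for t
      using g(3)[OF that] g(3)[OF b] by (intro poly_mapping_eqI) (metis of_nat_eq_iff)
    then have "Poly_Mapping.keys g = {b}" using b by blast
    then show ?thesis using g by blast
  qed
  then obtain g b where g: "\<And>i. i < ?l \<Longrightarrow> g i \<in> polys_on A" "\<And>i. i < ?l \<Longrightarrow> fst (D ! i) = \<phi> (g i)"
      "\<And>i. i < ?l \<Longrightarrow> Poly_Mapping.keys (g i) = {b i}"
    by metis
  have gA: "r * g i \<in> polys_on A" if "i < ?l" for r i
    using polys_on_mult_left[OF up_closed_A g(1)[OF that]] .
  have space: "stanley_space M (fst (D ! i)) (?Z i) = {\<phi> (r * g i) | r. r \<in> polynomials_in (?Z i)}"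
    if "i < ?l" for i
    using g(2)[OF that] phi_smult[OF g(1)[OF that]] by (auto simp: stanley_space_def)
  have unique: "\<exists>!y. y \<in> (\<Pi>\<^sub>E i\<in>{..<?l}. stanley_space M (fst (D ! i)) (?Z i)) \<and>
      x = (\<Oplus>\<^bsub>M\<^esub>i\<in>{..<?l}. y i)" if "x \<in> carrier M" for x
    using D that by (simp add: stanley_decomposition_def)
  show thesis
  proof (rule that[of b])
    show "b i \<in> A" if "i < ?l" for i
      using g(1,3)[OF that] by (auto simp: polys_on_def)
  next
    fix t assume t: "t \<in> A - A'"
    then have tA: "monomial t \<in> (polys_on A :: ('v, 'k) mpoly set)" by simp
    obtain y where y: "y \<in> (\<Pi>\<^sub>E i\<in>{..<?l}. stanley_space M (fst (D ! i)) (?Z i))"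
        "\<phi> (monomial t) = (\<Oplus>\<^bsub>M\<^esub>i\<in>{..<?l}. y i)"
      using unique[of "\<phi> (monomial t)"] tA unfolding carrier_eq by blast
    have "\<forall>i<?l. \<exists>r. r \<in> polynomials_in (?Z i) \<and> y i = \<phi> (r * g i)"
    proof (intro allI impI)
      fix i assume "i < ?l"
      then show "\<exists>r. r \<in> polynomials_in (?Z i) \<and> y i = \<phi> (r * g i)"
        using PiE_mem[OF y(1), of i] unfolding lessThan_iff space[OF \<open>i < ?l\<close>] by blast
    qed
    then obtain r where r: "\<And>i. i < ?l \<Longrightarrow> r i \<in> polynomials_in (?Z i)" "\<And>i. i < ?l \<Longrightarrow> y i = \<phi> (r i * g i)"
      by metis
    have "\<phi> (monomial t) = \<phi> (\<Sum>i<?l. r i * g i)"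
      unfolding y(2) by (rule finsum_phi) (simp_all add: r(2) gA)
    then have "monomial t - (\<Sum>i<?l. r i * g i) \<in> polys_on A'"
      using phi_eq_iff[OF tA, of "\<Sum>i<?l. r i * g i"] gA by (auto intro!: polys_on_sum)
    \<comment> \<open>Outside \<open>A'\<close> equal classes have equal coefficients, so some
      summand must contain \<open>t\<close>.\<close>
    then have "t \<notin> Poly_Mapping.keys (monomial t - (\<Sum>i<?l. r i * g i))"
      using t by (auto simp: polys_on_def)
    then have "t \<in> Poly_Mapping.keys (\<Sum>i<?l. r i * g i)"
      by (simp add: in_keys_iff lookup_minus)
    then obtain i where i: "i < ?l" "t \<in> Poly_Mapping.keys (r i * g i)"
      using keys_sum[of "\<lambda>i. r i * g i" "{..<?l}"] by auto
    then obtain z where "t = z + b i" "z \<in> Poly_Mapping.keys (r i)"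
      using keys_mult[of "r i" "g i"] g(3) by auto
    then have "t \<in> cone (b i) (?Z i)"
      using r(1)[OF i(1)] by (auto simp: cone_def polynomials_in_def)
    then show "\<exists>i<?l. t \<in> cone (b i) (?Z i)" using i(1) by blast
  next
    fix t i j assume t: "t \<in> A - A'" and ij: "i < ?l" "j < ?l" "i \<noteq> j"
    have tA: "monomial t \<in> (polys_on A :: ('v, 'k) mpoly set)" using t by simp
    \<comment> \<open>The family with the class of \<open>monomial t\<close> in one slot and zero
      elsewhere. If \<open>t\<close> lay in two cones, two such families would have the same
      sum.\<close>
    define y where "y = (\<lambda>i. restrict (\<lambda>l. if l = i then \<phi> (monomial t) else \<zero>) {..<?l})"
    have y: "y i \<in> (\<Pi>\<^sub>E i\<in>{..<?l}. stanley_space M (fst (D ! i)) (?Z i)) \<and>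
        \<phi> (monomial t) = (\<Oplus>\<^bsub>M\<^esub>l\<in>{..<?l}. y i l)"
      if i: "i < ?l" and ti: "t \<in> cone (b i) (?Z i)" for i
    proof
      obtain z where z: "t = z + b i" "Poly_Mapping.keys z \<subseteq> ?Z i" using ti by (auto simp: cone_def)
      define c where "c = Poly_Mapping.lookup (g i) (b i)"
      have "c \<noteq> 0" using g(3)[OF i] by (simp add: c_def in_keys_iff[symmetric])
      have gi: "g i = Poly_Mapping.single (b i) c"
        using poly_mapping_eq_sum_single[of "g i"] g(3)[OF i] by (simp add: c_def)
      have "monomial t = Poly_Mapping.single z (inverse c) * g i"
        using \<open>c \<noteq> 0\<close> by (simp add: gi mult_single monomial_def z(1))
      moreover have "Poly_Mapping.single z (inverse c) \<in> polynomials_in (?Z i)"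
        using z(2) by (simp add: polynomials_in_def)
      ultimately have "\<phi> (monomial t) \<in> stanley_space M (fst (D ! i)) (?Z i)"
        unfolding space[OF i] by (intro CollectI exI[of _ "Poly_Mapping.single z (inverse c)"]) simp
      moreover have "\<zero> \<in> stanley_space M (fst (D ! l)) (?Z l)" if "l < ?l" for l
        unfolding space[OF that] by (auto simp: polynomials_in_def simp flip: phi_0 intro!: exI[of _ 0])
      ultimately show "y i \<in> (\<Pi>\<^sub>E i\<in>{..<?l}. stanley_space M (fst (D ! i)) (?Z i))"
        by (auto simp: y_def)
      have "(\<Oplus>\<^bsub>M\<^esub>l\<in>{..<?l}. y i l) = \<phi> (\<Sum>l<?l. if l = i then monomial t else 0)"
        using tA by (intro finsum_phi) (auto simp: y_def phi_0)
      then show "\<phi> (monomial t) = (\<Oplus>\<^bsub>M\<^esub>l\<in>{..<?l}. y i l)" using i by simp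
    qed
    assume ti: "t \<in> cone (b i) (?Z i)"
    show "t \<notin> cone (b j) (?Z j)"
    proof
      assume "t \<in> cone (b j) (?Z j)"
      then have "y i = y j"
        using unique[of "\<phi> (monomial t)"] y[OF ij(1) ti] y[OF ij(2)] tA unfolding carrier_eq by blast
      then have "y i i = y j i" by simp
      then have "\<phi> (monomial t) = \<phi> 0" using ij by (simp add: y_def phi_0)
      then show False using t phi_eq_iff[OF tA, of 0] by simp
    qed
  qed
qed

end

text \<open>The upper bound on all decompositions makes the set under \<open>Max\<close> finite, and
  it forces \<open>D\<close> to be nonempty, without which \<open>Min\<close> would carry no
  information.\<close>

lemma sdepth_eqI:
  fixes M :: "(('v::finite, 'k::field) mpoly, 'm, 'v \<Rightarrow> int) graded_module"
  assumes "stanley_decomposition M D" "\<And>Z. Z \<in> snd ` set D \<Longrightarrow> d \<le> card Z"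
    and upper: "\<And>D. stanley_decomposition M D \<Longrightarrow> \<exists>Z\<in>snd ` set D. card Z \<le> d"
  shows "sdepth M = d"
proof -
  let ?X = "{Min (card ` snd ` set D) | D. stanley_decomposition M D}"
  have le: "Min (card ` snd ` set D) \<le> d" if D: "stanley_decomposition M D" for D
  proof -
    obtain Z where "Z \<in> snd ` set D" "card Z \<le> d" using upper[OF D] by blast
    then show ?thesis by (meson List.finite_set Min_le finite_imageI imageI le_trans)
  qed
  have "set D \<noteq> {}" using upper[OF assms(1)] by auto
  then have "d \<le> Min (card ` snd ` set D)"
    using assms(2) by (subst Min_ge_iff) auto
  then have "Min (card ` snd ` set D) = d" using le[OF assms(1)] by simp
  moreover have "finite ?X"
    using le by (intro finite_subset[of ?X "{..d}"]) auto
  ultimately show ?thesis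
    unfolding sdepth_def using le assms(1) by (intro Max_eqI) auto
qed

section \<open>Ideals and quotients of ideals as monomial modules\<close>

lemma monomial_module_ideal:
  assumes "up_closed A" "A \<noteq> {}"
  shows "monomial_module (ideal_module (polys_on A) :: (_, ('v::finite, 'k::field) mpoly, _) graded_module) id A {}"
  using assms by unfold_locales (auto simp: ideal_module_def component_polys_def)

lemma monomial_module_quotient:
  fixes A A' :: "('v::finite \<Rightarrow>\<^sub>0 nat) set"
  assumes "up_closed A" "up_closed A'" "A - A' \<noteq> {}"
  defines "I \<equiv> ideal_module (polys_on A) :: (_, ('v, 'k::field) mpoly, _) graded_module"
  shows "monomial_module (quotient_module I (polys_on A')) (\<lambda>p. polys_on A' +>\<^bsub>I\<^esub> p) A A'"
proof -
  let ?N = "polys_on A' :: ('v, 'k) mpoly set"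
  let ?\<phi> = "\<lambda>p. ?N +>\<^bsub>I\<^esub> p"
  have phi: "?\<phi> p = {q. q - p \<in> ?N}" for p
    by (force simp: a_r_coset_def r_coset_def I_def ideal_module_def intro!: bexI[of _ "_ - p"])
  have eq_iff: "?\<phi> p = ?\<phi> q \<longleftrightarrow> p - q \<in> ?N" for p q
  proof
    assume "?\<phi> p = ?\<phi> q"
    moreover have "p \<in> ?\<phi> p" by (simp add: phi)
    ultimately show "p - q \<in> ?N" by (simp add: phi)
  next
    assume pq: "p - q \<in> ?N"
    have "x - p \<in> ?N \<longleftrightarrow> x - q \<in> ?N" for x
      using polys_on_add[OF _ pq, of "x - p"] polys_on_diff[OF _ pq, of "x - q"] by auto
    then show "?\<phi> p = ?\<phi> q" by (simp add: phi)
  qed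
  have ring_sum: "p \<oplus>\<^bsub>I\<^esub> q = p + q" and sm: "r \<odot>\<^bsub>I\<^esub> p = r * p" and cI: "carrier I = polys_on A" for p q r
    by (simp_all add: I_def ideal_module_def)
  show ?thesis
  proof
    show "carrier (quotient_module I ?N) = ?\<phi> ` polys_on A"
      by (auto simp: quotient_module_def A_RCOSETS_def RCOSETS_def a_r_coset_def cI)
    show "?\<phi> (p + q) = ?\<phi> p \<oplus>\<^bsub>quotient_module I ?N\<^esub> ?\<phi> q" for p q
    proof -
      have "set_add I (?\<phi> p) (?\<phi> q) = {x + y | x y. x \<in> ?\<phi> p \<and> y \<in> ?\<phi> q}"
        by (auto simp: set_add_def set_mult_def I_def ideal_module_def)
      also have "\<dots> = ?\<phi> (p + q)"
      proof (intro equalityI subsetI)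
        fix z assume "z \<in> {x + y | x y. x \<in> ?\<phi> p \<and> y \<in> ?\<phi> q}"
        then obtain x y where "z = x + y" "x - p \<in> ?N" "y - q \<in> ?N" by (auto simp: phi)
        then show "z \<in> ?\<phi> (p + q)"
          using polys_on_add[of "x - p" A' "y - q"] by (simp add: phi algebra_simps)
      next
        fix z assume "z \<in> ?\<phi> (p + q)"
        then have "z - q \<in> ?\<phi> p" "q \<in> ?\<phi> q" "z = (z - q) + q"
          by (simp_all add: phi algebra_simps)
        then show "z \<in> {x + y | x y. x \<in> ?\<phi> p \<and> y \<in> ?\<phi> q}" by blast
      qed
      finally show ?thesis by (simp add: quotient_module_def)
    qed
    show "?\<phi> 0 = \<zero>\<^bsub>quotient_module I ?N\<^esub>"
      by (simp add: quotient_module_def phi)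
    show "?\<phi> (r * p) = r \<odot>\<^bsub>quotient_module I ?N\<^esub> ?\<phi> p" for r p
    proof -
      have "?\<phi> (r * x) = ?\<phi> (r * p)" if "x \<in> ?\<phi> p" for x
        using that polys_on_mult_left[OF assms(2), of "x - p" r] unfolding eq_iff
        by (simp add: phi algebra_simps)
      moreover have "p \<in> ?\<phi> p" by (simp add: phi)
      \<comment> \<open>The union defining scalar multiplication runs over representatives that all
        give the same coset, so it collapses to one.\<close>
      ultimately have "(\<Union>x\<in>?\<phi> p. ?\<phi> (r * x)) = ?\<phi> (r * p)" by blast
      then show ?thesis by (simp add: quotient_module_def sm)
    qed
    show "?\<phi> p = ?\<phi> q \<longleftrightarrow> p - q \<in> ?N" for p q by (rule eq_iff)
    show "component (quotient_module I ?N) a = ?\<phi> ` component_polys (polys_on A) a" for a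
      by (simp add: quotient_module_def I_def ideal_module_def component_polys_def)
  qed (use assms in auto)
qed

section \<open>Powers of an ideal generated by monomials with disjoint supports\<close>

lemma cone_iff:
  fixes t a :: "'v::finite \<Rightarrow>\<^sub>0 nat"
  shows "t \<in> cone a Z \<longleftrightarrow>
    (\<forall>v. Poly_Mapping.lookup a v \<le> Poly_Mapping.lookup t v \<and>
         (v \<notin> Z \<longrightarrow> Poly_Mapping.lookup t v = Poly_Mapping.lookup a v))"
    (is "_ \<longleftrightarrow> ?R")
proof
  assume "t \<in> cone a Z"
  then obtain b where "t = b + a" "Poly_Mapping.keys b \<subseteq> Z" by (auto simp: cone_def)
  then show ?R by (auto simp: lookup_add in_keys_iff)
next
  assume R: ?R
  then have "t = (t - a) + a" by (intro poly_mapping_eqI) (simp add: lookup_add lookup_minus)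
  moreover have "Poly_Mapping.keys (t - a) \<subseteq> Z"
    using R by (auto simp: in_keys_iff lookup_minus)
  ultimately show "t \<in> cone a Z" unfolding cone_def by blast
qed

lemma finite_bounded_exponents:
  fixes N :: "'v::finite \<Rightarrow> nat"
  shows "finite {a. \<forall>v. Poly_Mapping.lookup a v \<le> N v}"
proof (rule finite_imageD)
  show "finite (Poly_Mapping.lookup ` {a. \<forall>v. Poly_Mapping.lookup a v \<le> N v})"
    by (rule finite_subset[of _ "PiE UNIV (\<lambda>v. {..N v})"]) (auto intro!: finite_PiE)
  show "inj_on Poly_Mapping.lookup {a. \<forall>v. Poly_Mapping.lookup a v \<le> N v}"
    by (auto intro!: inj_onI poly_mapping_eqI)
qed

text \<open>The exponents of the minimal generators: \<open>u_neq_0\<close> reflects that the ideal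
  is proper, \<open>m_pos\<close> that it is nonzero.\<close>

locale disjoint_exponents =
  fixes u :: "nat \<Rightarrow> ('v::finite \<Rightarrow>\<^sub>0 nat)" and m :: nat
  assumes u_neq_0: "j < m \<Longrightarrow> u j \<noteq> 0"
    and keys_disjoint: "i < m \<Longrightarrow> j < m \<Longrightarrow> i \<noteq> j \<Longrightarrow>
      Poly_Mapping.keys (u i) \<inter> Poly_Mapping.keys (u j) = {}"
    and m_pos: "0 < m"
begin

abbreviation supp :: "nat \<Rightarrow> 'v set"
  where "supp j \<equiv> Poly_Mapping.keys (u j)"

definition ord :: "nat \<Rightarrow> ('v \<Rightarrow>\<^sub>0 nat) \<Rightarrow> nat"
  where "ord j t = Min ((\<lambda>v. Poly_Mapping.lookup t v div Poly_Mapping.lookup (u j) v) ` supp j)"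

definition weight :: "('v \<Rightarrow>\<^sub>0 nat) \<Rightarrow> nat"
  where "weight t = (\<Sum>j<m. ord j t)"

definition heavy :: "nat \<Rightarrow> ('v \<Rightarrow>\<^sub>0 nat) set"
  where "heavy n = {t. n \<le> weight t}"

lemma supp_nonempty: "j < m \<Longrightarrow> supp j \<noteq> {}"
  using u_neq_0 by simp

lemma supp_unique: "i < m \<Longrightarrow> j < m \<Longrightarrow> v \<in> supp i \<Longrightarrow> v \<in> supp j \<Longrightarrow> i = j"
  using keys_disjoint by blast

text \<open>Integer division by a positive number is adjoint to multiplication. Most facts about
  \<open>ord\<close> are derived from this form.\<close>

lemma le_ord_iff:
  assumes "j < m"
  shows "x \<le> ord j t \<longleftrightarrow> (\<forall>v\<in>supp j. x * Poly_Mapping.lookup (u j) v \<le> Poly_Mapping.lookup t v)"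
proof -
  have "x \<le> ord j t \<longleftrightarrow> (\<forall>v\<in>supp j. x \<le> Poly_Mapping.lookup t v div Poly_Mapping.lookup (u j) v)"
    using supp_nonempty[OF assms] by (simp add: ord_def)
  also have "\<dots> \<longleftrightarrow> (\<forall>v\<in>supp j. x * Poly_Mapping.lookup (u j) v \<le> Poly_Mapping.lookup t v)"
    by (intro ball_cong refl less_eq_div_iff_mult_less_eq) (simp add: in_keys_iff)
  finally show ?thesis .
qed

lemma ord_add_ge: "j < m \<Longrightarrow> ord j s + ord j t \<le> ord j (s + t)"
  using le_ord_iff[of j "ord j s" s] le_ord_iff[of j "ord j t" t] le_ord_iff[of j "ord j s + ord j t" "s + t"]
  by (auto simp: lookup_add add_mult_distrib intro!: add_mono)

lemma weight_add_ge: "weight s + weight t \<le> weight (s + t)"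
  unfolding weight_def sum.distrib[symmetric] by (intro sum_mono ord_add_ge) simp

lemma up_closed_heavy: "up_closed (heavy n)"
  unfolding up_closed_def heavy_def
proof (intro ballI allI)
  fix t s assume "t \<in> {t. n \<le> weight t}"
  then show "t + s \<in> {t. n \<le> weight t}" using weight_add_ge[of t s] by simp
qed

lemma heavy_0 [simp]: "heavy 0 = UNIV"
  by (simp add: heavy_def)

text \<open>The exponent of the product of the generators raised to the powers \<open>e j\<close>.
  Those with sum \<open>n\<close> are the minimal generators of the \<open>n\<close>-th
  power.\<close>

definition comb :: "(nat \<Rightarrow> nat) \<Rightarrow> ('v \<Rightarrow>\<^sub>0 nat)"
  where "comb e = Abs_poly_mapping (\<lambda>v. \<Sum>j<m. e j * Poly_Mapping.lookup (u j) v)"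

lemma lookup_comb: "Poly_Mapping.lookup (comb e) v = (\<Sum>j<m. e j * Poly_Mapping.lookup (u j) v)"
  by (simp add: comb_def)

lemma sum_supp:
  assumes "j < m" "v \<in> supp j"
  shows "(\<Sum>i<m. if v \<in> supp i then g i else 0) = (g j :: nat)"
proof -
  have "(\<Sum>i<m. if v \<in> supp i then g i else 0) = (\<Sum>i<m. if i = j then g j else 0)"
    using assms supp_unique by (intro sum.cong refl) auto
  then show ?thesis using assms by simp
qed

lemma lookup_comb_supp:
  assumes "j < m" "v \<in> supp j"
  shows "Poly_Mapping.lookup (comb e) v = e j * Poly_Mapping.lookup (u j) v"
proof -
  have "(\<Sum>i<m. e i * Poly_Mapping.lookup (u i) v) =
      (\<Sum>i<m. if v \<in> supp i then e i * Poly_Mapping.lookup (u i) v else 0)"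
    by (intro sum.cong refl) (simp add: in_keys_iff)
  also have "\<dots> = e j * Poly_Mapping.lookup (u j) v" by (rule sum_supp[OF assms])
  finally show ?thesis by (simp add: lookup_comb)
qed

lemma ord_comb:
  assumes "j < m"
  shows "ord j (comb e) = e j"
proof (rule antisym)
  obtain v where v: "v \<in> supp j" using supp_nonempty[OF assms] by blast
  have "ord j (comb e) * Poly_Mapping.lookup (u j) v \<le> e j * Poly_Mapping.lookup (u j) v"
    using le_ord_iff[OF assms, of "ord j (comb e)" "comb e"] v lookup_comb_supp[OF assms v] by auto
  moreover have "0 < Poly_Mapping.lookup (u j) v" using v by (simp add: in_keys_iff)
  ultimately show "ord j (comb e) \<le> e j" by simp
  show "e j \<le> ord j (comb e)"
    using le_ord_iff[OF assms] lookup_comb_supp[OF assms] by simp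
qed

lemma weight_comb: "weight (comb e) = (\<Sum>j<m. e j)"
  by (simp add: weight_def ord_comb)

lemma comb_le:
  assumes "\<And>j. j < m \<Longrightarrow> e j \<le> ord j t"
  shows "Poly_Mapping.lookup (comb e) v \<le> Poly_Mapping.lookup t v"
proof (cases "\<exists>j<m. v \<in> supp j")
  case True
  then obtain j where j: "j < m" "v \<in> supp j" by blast
  then show ?thesis using le_ord_iff[OF j(1)] assms[OF j(1)] lookup_comb_supp[OF j] by simp
next
  case False
  then have "Poly_Mapping.lookup (comb e) v = 0" by (simp add: lookup_comb in_keys_iff)
  then show ?thesis by simp
qed

lemma ord_u: "i < m \<Longrightarrow> j < m \<Longrightarrow> ord j (u i) = (if j = i then 1 else 0)"
proof -
  assume ij: "i < m" "j < m"
  have "u i = comb (\<lambda>j. if j = i then 1 else 0)"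
    using ij by (intro poly_mapping_eqI) (simp add: lookup_comb if_distrib[of "\<lambda>x. x * _"] cong: if_cong)
  then show ?thesis using ij by (simp add: ord_comb)
qed

lemma weight_u: "i < m \<Longrightarrow> weight (u i) = 1"
  by (simp add: weight_def ord_u)

lemma up_closure_u: "up_closure (u ` {..<m}) = heavy 1"
proof
  show "up_closure (u ` {..<m}) \<subseteq> heavy 1"
  proof
    fix t assume "t \<in> up_closure (u ` {..<m})"
    then obtain j s where "j < m" "t = u j + s" by (auto simp: up_closure_def)
    then show "t \<in> heavy 1"
      using weight_u[of j] weight_add_ge[of "u j" s] by (simp add: heavy_def)
  qed
  show "heavy 1 \<subseteq> up_closure (u ` {..<m})"
  proof
    fix t assume "t \<in> heavy 1"
    then obtain j where j: "j < m" "1 \<le> ord j t"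
      by (auto simp: heavy_def weight_def simp flip: not_less_eq_eq) 
    have "Poly_Mapping.lookup (u j) v \<le> Poly_Mapping.lookup t v" for v
      using j le_ord_iff[OF j(1), of 1 t] by (cases "v \<in> supp j") (auto simp: in_keys_iff)
    then obtain s where "t = u j + s" using exponent_le_iff[where a = "u j" and b = t] by blast
    then show "t \<in> up_closure (u ` {..<m})"
      using j(1) unfolding up_closure_def by blast
  qed
qed

text \<open>Splitting off a generator \<open>u j\<close> that divides \<open>t\<close> lowers the
  weight by at most one: the order at \<open>j\<close> drops by at most one, and disjointness of the
  supports protects the other orders.\<close>

lemma heavy_Suc:
  assumes "t \<in> heavy (Suc n)"
  shows "\<exists>s\<in>heavy n. \<exists>r\<in>heavy 1. t = s + r"
proof -
  have "t \<in> heavy 1" using assms by (simp add: heavy_def)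
  then obtain j s where j: "j < m" "t = u j + s"
    unfolding up_closure_u[symmetric] up_closure_def by auto
  have "ord i t \<le> ord i s + (if i = j then 1 else 0)" if i: "i < m" for i
  proof -
    have "ord i t - (if i = j then 1 else 0) \<le> ord i s"
      unfolding le_ord_iff[OF i]
    proof
      fix v assume v: "v \<in> supp i"
      have "ord i t * Poly_Mapping.lookup (u i) v \<le> Poly_Mapping.lookup (u j) v + Poly_Mapping.lookup s v"
        using le_ord_iff[OF i, of "ord i t" t] v by (simp add: j(2) lookup_add)
      moreover have "Poly_Mapping.lookup (u j) v = 0" if "i \<noteq> j"
        using supp_unique[OF i j(1) v] that by (auto simp: in_keys_iff)
      ultimately show "(ord i t - (if i = j then 1 else 0)) * Poly_Mapping.lookup (u i) v \<le> Poly_Mapping.lookup s v"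
        by (auto simp: diff_mult_distrib)
    qed
    then show ?thesis by auto
  qed
  then have "weight t \<le> (\<Sum>i<m. ord i s + (if i = j then 1 else 0))"
    unfolding weight_def by (intro sum_mono) simp
  also have "\<dots> = weight s + 1" using j(1) by (simp add: sum.distrib weight_def)
  finally have "s \<in> heavy n" using assms by (simp add: heavy_def)
  moreover have "u j \<in> heavy 1" using weight_u[OF j(1)] by (simp add: heavy_def)
  ultimately show ?thesis using j(2) by (metis add.commute)
qed

lemma ideal_power_heavy:
  "ideal_power (polys_on (heavy 1)) n = (polys_on (heavy n) :: ('v, 'k::field) mpoly set)"
proof (induction n)
  case 0
  show ?case by (simp add: ideals_set_def nat_pow_def)
next
  case (Suc n)
  let ?J = "\<lambda>n. polys_on (heavy n) :: ('v, 'k) mpoly set"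
  interpret ring "polynomial_ring :: ('v, 'k) mpoly ring" by (rule ring_polynomial_ring)
  have id: "ideal (?J n) polynomial_ring" for n
    by (rule ideal_polys_on[OF up_closed_heavy])
  have "ideal_power (?J 1) (Suc n) = ideal_prod polynomial_ring (?J n) (?J 1)"
    using Suc.IH by (simp add: ideals_set_def nat_pow_def)
  also have "\<dots> = ?J (Suc n)"
  proof
    show "ideal_prod polynomial_ring (?J n) (?J 1) \<subseteq> ?J (Suc n)"
    proof
      fix p :: "('v, 'k) mpoly" assume "p \<in> ideal_prod polynomial_ring (?J n) (?J 1)"
      then show "p \<in> ?J (Suc n)"
      proof (induction rule: ideal_prod.induct)
        case (prod p q)
        have "a + b \<in> heavy (Suc n)" if "a \<in> heavy n" "b \<in> heavy 1" for a b
          using that weight_add_ge[of a b] by (simp add: heavy_def)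
        then show ?case using prod keys_mult[of p q] by (fastforce simp: polys_on_def)
      qed (simp add: polys_on_add)
    qed
    show "?J (Suc n) \<subseteq> ideal_prod polynomial_ring (?J n) (?J 1)"
    proof
      fix p :: "('v, 'k) mpoly" assume p: "p \<in> ?J (Suc n)"
      show "p \<in> ideal_prod polynomial_ring (?J n) (?J 1)"
      proof (rule mem_ideal_if_monomials[OF ideal_prod_is_ideal[OF id id]])
        fix t assume "t \<in> Poly_Mapping.keys p"
        then obtain s r where "s \<in> heavy n" "r \<in> heavy 1" "t = s + r"
          using p heavy_Suc[of t n] by (auto simp: polys_on_def)
        then show "monomial t \<in> ideal_prod polynomial_ring (?J n) (?J 1)"
          using ideal_prod.prod[of "monomial s" "?J n" "monomial r" "?J 1" polynomial_ring]
          by (simp add: monomial_add)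
      qed
    qed
  qed
  finally show ?case .
qed

text \<open>Minimality of the generators of the \<open>n\<close>-th power. Each order of
  \<open>b\<close> is at most \<open>e j\<close>, the total weight forces equality, and then
  \<open>comb e\<close> divides \<open>b\<close> in turn.\<close>

lemma comb_weight:
  assumes "(\<Sum>j<m. e j) = n" "b \<in> heavy n"
    and le: "\<And>v. Poly_Mapping.lookup b v \<le> Poly_Mapping.lookup (comb e) v"
  shows "b = comb e"
proof -
  have ge: "ord j b \<le> e j" if j: "j < m" for j
    using le_ord_iff[OF j, of "ord j b" b] le_ord_iff[OF j, of "ord j b" "comb e"] le ord_comb[OF j, of e]
    by (auto intro: order_trans)
  have "\<not> ord j b < e j" if j: "j < m" for j
  proof
    assume "ord j b < e j"
    then have "weight b < (\<Sum>j<m. e j)"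
      unfolding weight_def using ge j by (intro sum_strict_mono_ex1) auto
    then show False using assms by (simp add: heavy_def)
  qed
  then have "Poly_Mapping.lookup (comb e) v \<le> Poly_Mapping.lookup b v" for v
    by (intro comb_le) (simp add: not_less)
  then show ?thesis using le by (intro poly_mapping_eqI antisym) auto
qed

text \<open>Variables chosen from different supports are different. This count gives the dimensions
  of the constructed cones as well as upper bounds.\<close>

lemma card_avoiding:
  assumes "k \<le> m" "\<And>j. j < k \<Longrightarrow> w j \<in> supp j"
  shows "card (- w ` {..<k}) + k = CARD('v)"
proof -
  have "inj_on w {..<k}"
  proof (rule inj_onI)
    fix i j assume "i \<in> {..<k}" "j \<in> {..<k}" "w i = w j"
    then show "i = j" using assms(1) assms(2)[of i] assms(2)[of j] supp_unique[of i j "w i"] by auto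
  qed
  then have "card (w ` {..<k}) = k" by (simp add: card_image)
  then show ?thesis
    using card_mono[of UNIV "w ` {..<k}"] by (simp add: Compl_eq_Diff_UNIV card_Diff_subset)
qed

lemma m_le_card: "m \<le> CARD('v)"
proof -
  have "\<forall>j. \<exists>v. j < m \<longrightarrow> v \<in> supp j"
    using supp_nonempty by blast
  then obtain w where "\<And>j. j < m \<Longrightarrow> w j \<in> supp j"
    by metis
  then show ?thesis using card_avoiding[of m w] by simp
qed

end

section \<open>Stanley depth\<close>

context disjoint_exponents
begin

text \<open>
  The classifier records the orders \<open>ord 0 t, ord 1 t, \<dots>\<close> until their sum reaches \<open>n\<close>, and for each
  recorded order the first variable (in the enumeration \<open>enum\<close>) that prevents it from being larger.
  The exponent of that variable is frozen.
\<close>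

definition enum :: "'v \<Rightarrow> nat"
  where "enum = (SOME f. inj f)"

lemma inj_enum: "inj enum"
proof -
  obtain f :: "'v \<Rightarrow> nat" where "inj f"
    using finite_imp_inj_to_nat_seg[of "UNIV :: 'v set"] by auto
  then show ?thesis unfolding enum_def by (rule someI[of inj])
qed

text \<open>The sum includes index \<open>k\<close>, so the order at the stopping index itself is
  not recorded; only the indices below it have a frozen variable. The value \<open>m\<close> means
  that \<open>n\<close> is never reached.\<close>

definition stop :: "nat \<Rightarrow> ('v \<Rightarrow>\<^sub>0 nat) \<Rightarrow> nat"
  where "stop n t = (LEAST k. k = m \<or> n \<le> (\<Sum>j<Suc k. ord j t))"

definition blocking :: "nat \<Rightarrow> ('v \<Rightarrow>\<^sub>0 nat) \<Rightarrow> 'v"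
  where "blocking j t = arg_min enum (\<lambda>v. v \<in> supp j \<and>
    Poly_Mapping.lookup t v < (ord j t + 1) * Poly_Mapping.lookup (u j) v)"

text \<open>The least exponents compatible with the recorded data. Below \<open>stop\<close>,
  variables before the blocking one must admit one more power of the generator and those after it
  only the recorded power. At \<open>stop\<close> the generator must divide often enough to supply
  what is missing to \<open>n\<close>. Later supports are unconstrained.\<close>

definition apex_coeff :: "nat \<Rightarrow> ('v \<Rightarrow>\<^sub>0 nat) \<Rightarrow> nat \<Rightarrow> 'v \<Rightarrow> nat"
  where "apex_coeff n t j v =
    (if j < stop n t then
       if v = blocking j t then Poly_Mapping.lookup t v
       else if enum v < enum (blocking j t) then (ord j t + 1) * Poly_Mapping.lookup (u j) v
       else ord j t * Poly_Mapping.lookup (u j) v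
     else if j = stop n t then (n - (\<Sum>i<j. ord i t)) * Poly_Mapping.lookup (u j) v
     else 0)"

definition classifier :: "nat \<Rightarrow> ('v \<Rightarrow>\<^sub>0 nat) \<Rightarrow> ('v \<Rightarrow>\<^sub>0 nat) \<times> 'v set"
  where "classifier n t =
    (Abs_poly_mapping (\<lambda>v. \<Sum>j<m. if v \<in> supp j then apex_coeff n t j v else 0),
     - (\<lambda>j. blocking j t) ` {..<stop n t})"

lemma lookup_classifier:
  assumes "j < m" "v \<in> supp j"
  shows "Poly_Mapping.lookup (fst (classifier n t)) v = apex_coeff n t j v"
  using sum_supp[OF assms] by (simp add: classifier_def)

lemma lookup_classifier_outside:
  assumes "\<And>j. j < m \<Longrightarrow> v \<notin> supp j"
  shows "Poly_Mapping.lookup (fst (classifier n t)) v = 0"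
  using assms by (simp add: classifier_def)

lemma snd_classifier: "snd (classifier n t) = - (\<lambda>j. blocking j t) ` {..<stop n t}"
  by (simp add: classifier_def)

lemma blocking:
  assumes j: "j < m"
  shows "blocking j t \<in> supp j"
    and "Poly_Mapping.lookup t (blocking j t) < (ord j t + 1) * Poly_Mapping.lookup (u j) (blocking j t)"
    and "\<And>v. v \<in> supp j \<Longrightarrow> enum v < enum (blocking j t) \<Longrightarrow>
      (ord j t + 1) * Poly_Mapping.lookup (u j) v \<le> Poly_Mapping.lookup t v"
proof -
  let ?P = "\<lambda>v. v \<in> supp j \<and> Poly_Mapping.lookup t v < (ord j t + 1) * Poly_Mapping.lookup (u j) v"
  have "\<not> ord j t + 1 \<le> ord j t" by simp
  \<comment> \<open>A blocking variable exists because \<open>ord j t\<close> is the largest power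
    that divides.\<close>
  then obtain w where w: "?P w" unfolding le_ord_iff[OF j] not_le[symmetric] by blast
  have "?P (blocking j t)"
    unfolding blocking_def by (rule arg_min_natI[of ?P, OF w])
  then show "blocking j t \<in> supp j"
    "Poly_Mapping.lookup t (blocking j t) < (ord j t + 1) * Poly_Mapping.lookup (u j) (blocking j t)"
    by blast+
  fix v assume v: "v \<in> supp j" "enum v < enum (blocking j t)"
  then have "\<not> ?P v"
    using arg_min_nat_le[of ?P v enum] unfolding blocking_def by linarith
  then show "(ord j t + 1) * Poly_Mapping.lookup (u j) v \<le> Poly_Mapping.lookup t v"
    using v(1) by simp
qed

lemma blocking_eqI:
  assumes j: "j < m" and w: "w \<in> supp j" "Poly_Mapping.lookup t w < (ord j t + 1) * Poly_Mapping.lookup (u j) w"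
    and "\<And>v. v \<in> supp j \<Longrightarrow> enum v < enum w \<Longrightarrow>
      (ord j t + 1) * Poly_Mapping.lookup (u j) v \<le> Poly_Mapping.lookup t v"
  shows "blocking j t = w"
proof -
  have "\<not> enum (blocking j t) < enum w"
    using assms(4)[of "blocking j t"] blocking(1,2)[OF j, of t] by auto
  moreover have "\<not> enum w < enum (blocking j t)"
    using blocking(3)[OF j w(1), of t] w(2) by auto
  ultimately have "enum (blocking j t) = enum w" by simp
  then show ?thesis using inj_enum by (simp add: inj_def)
qed

lemma stop: "stop n t = m \<or> n \<le> (\<Sum>j<Suc (stop n t). ord j t)"
  unfolding stop_def by (rule LeastI[of "\<lambda>k. k = m \<or> n \<le> (\<Sum>j<Suc k. ord j t)" m]) simp

lemma stop_le: "stop n t \<le> m"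
  unfolding stop_def by (rule Least_le) simp

lemma below_stop: "k < stop n t \<Longrightarrow> (\<Sum>j<Suc k. ord j t) < n"
  using not_less_Least[of k "\<lambda>k. k = m \<or> n \<le> (\<Sum>j<Suc k. ord j t)"] unfolding stop_def by auto

text \<open>Source of the extra dimension: for weight at least \<open>n\<close> fewer than
  \<open>m\<close> variables are frozen, and otherwise exactly \<open>m\<close>.\<close>

lemma stop_less_iff: "stop n t < m \<longleftrightarrow> n \<le> weight t"
proof
  assume less: "stop n t < m"
  then have "n \<le> (\<Sum>j<Suc (stop n t). ord j t)" using stop[of n t] by auto
  also have "\<dots> \<le> weight t" unfolding weight_def using less by (intro sum_mono2) auto
  finally show "n \<le> weight t" .
next
  assume n: "n \<le> weight t"
  have "\<not> m - 1 < stop n t" using below_stop[of "m - 1" n t] n m_pos by (auto simp: weight_def)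
  then show "stop n t < m" using m_pos by linarith
qed

lemma apex_coeff_le:
  assumes j: "j < m" "v \<in> supp j"
  shows "apex_coeff n t j v \<le> Poly_Mapping.lookup t v"
proof -
  have ord: "x * Poly_Mapping.lookup (u j) v \<le> Poly_Mapping.lookup t v" if "x \<le> ord j t" for x
    using le_ord_iff[OF j(1), of x t] that j(2) by blast
  consider "j < stop n t" | "j = stop n t" | "stop n t < j" by linarith
  then show ?thesis
  proof cases
    case 1
    then show ?thesis using ord[of "ord j t"] blocking(3)[OF j, of t] by (auto simp: apex_coeff_def)
  next
    case 2
    then have "n \<le> (\<Sum>i<j. ord i t) + ord j t" using stop[of n t] j(1) by auto
    then show ?thesis using 2 ord[of "n - (\<Sum>i<j. ord i t)"] by (simp add: apex_coeff_def)
  qed (simp add: apex_coeff_def)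
qed

lemma in_cone_classifier: "t \<in> cone (fst (classifier n t)) (snd (classifier n t))"
  unfolding cone_iff
proof (intro allI conjI impI)
  fix v
  show "Poly_Mapping.lookup (fst (classifier n t)) v \<le> Poly_Mapping.lookup t v"
    using lookup_classifier[of _ v n t] apex_coeff_le[of _ v n t] lookup_classifier_outside[of v n t]
    by (cases "\<exists>j<m. v \<in> supp j") auto
  assume "v \<notin> snd (classifier n t)"
  then obtain j where j: "j < stop n t" "v = blocking j t" by (auto simp: snd_classifier)
  then have "j < m" using stop_le[of n t] by simp
  then show "Poly_Mapping.lookup t v = Poly_Mapping.lookup (fst (classifier n t)) v"
    using j lookup_classifier[OF \<open>j < m\<close>, of v n t] blocking(1)[OF \<open>j < m\<close>, of t]
    by (simp add: apex_coeff_def)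
qed

section \<open>The classifier is constant on the cone that it assigns\<close>

context
  fixes n t t'
  assumes t': "t' \<in> cone (fst (classifier n t)) (snd (classifier n t))"
begin

lemma cone_ge: "j < m \<Longrightarrow> v \<in> supp j \<Longrightarrow> apex_coeff n t j v \<le> Poly_Mapping.lookup t' v"
  using t' lookup_classifier[of j v n t] unfolding cone_iff by metis

lemma cone_blocking:
  assumes "j < stop n t"
  shows "Poly_Mapping.lookup t' (blocking j t) = Poly_Mapping.lookup t (blocking j t)"
proof -
  have "blocking j t \<notin> snd (classifier n t)" using assms by (simp add: snd_classifier)
  then show ?thesis using t' in_cone_classifier[of t n] unfolding cone_iff by metis
qed

text \<open>The apex keeps the order from dropping, and the unchanged exponent of the blocking
  variable keeps it from growing.\<close>

lemma cone_ord:
  assumes j: "j < stop n t"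
  shows "ord j t' = ord j t"
proof -
  have jm: "j < m" using j stop_le[of n t] by simp
  have "ord j t * Poly_Mapping.lookup (u j) v \<le> Poly_Mapping.lookup t' v" if v: "v \<in> supp j" for v
  proof -
    have "ord j t * Poly_Mapping.lookup (u j) v \<le> apex_coeff n t j v"
      using le_ord_iff[OF jm, of "ord j t" t] v j by (auto simp: apex_coeff_def)
    then show ?thesis using cone_ge[OF jm v] by simp
  qed
  then have "ord j t \<le> ord j t'" using le_ord_iff[OF jm] by blast
  moreover have "\<not> ord j t + 1 \<le> ord j t'"
    unfolding le_ord_iff[OF jm] using cone_blocking[OF j] blocking(1,2)[OF jm, of t]
    by (intro notI) (metis leD)
  ultimately show ?thesis by simp
qed

text \<open>The partial sums before the stopping index are frozen, and at that index the lower bound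
  built into the apex still reaches \<open>n\<close>.\<close>

lemma cone_stop: "stop n t' = stop n t"
proof -
  let ?k = "stop n t"
  have sum: "(\<Sum>i<k. ord i t') = (\<Sum>i<k. ord i t)" if "k \<le> ?k" for k
    using that by (intro sum.cong refl cone_ord) simp
  have "?k = m \<or> n \<le> (\<Sum>j<Suc ?k. ord j t')"
  proof (cases "?k = m")
    case False
    then have k: "?k < m" using stop_le[of n t] by simp
    have "n - (\<Sum>i<?k. ord i t) \<le> ord ?k t'"
      unfolding le_ord_iff[OF k] using cone_ge[OF k] by (simp add: apex_coeff_def)
    then have "n \<le> (\<Sum>i<?k. ord i t) + ord ?k t'" by linarith
    then show ?thesis using sum[of ?k] by simp
  qed simp
  moreover have "\<not> (k = m \<or> n \<le> (\<Sum>j<Suc k. ord j t'))" if "k < ?k" for k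
    using that stop_le[of n t] below_stop[OF that] sum[of "Suc k"] by auto
  ultimately show ?thesis
    unfolding stop_def[of n t'] by (intro Least_equality) (auto simp: not_less[symmetric])
qed

text \<open>The raised apex exponents before the blocking variable prevent any earlier variable from
  becoming blocking.\<close>

lemma cone_blocking_eq:
  assumes j: "j < stop n t"
  shows "blocking j t' = blocking j t"
proof (rule blocking_eqI)
  show jm: "j < m" using j stop_le[of n t] by simp
  show "blocking j t \<in> supp j" by (rule blocking(1)[OF jm])
  show "Poly_Mapping.lookup t' (blocking j t) < (ord j t' + 1) * Poly_Mapping.lookup (u j) (blocking j t)"
    using blocking(2)[OF jm, of t] by (simp add: cone_ord[OF j] cone_blocking[OF j])
  show "(ord j t' + 1) * Poly_Mapping.lookup (u j) v \<le> Poly_Mapping.lookup t' v"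
    if "v \<in> supp j" "enum v < enum (blocking j t)" for v
    using cone_ge[OF jm that(1)] that(2) j by (auto simp: apex_coeff_def cone_ord[OF j] split: if_splits)
qed

lemma cone_classifier: "classifier n t' = classifier n t"
proof -
  have "apex_coeff n t' = apex_coeff n t"
  proof (intro ext)
    fix j v
    have "(\<Sum>i<stop n t. ord i t') = (\<Sum>i<stop n t. ord i t)"
      by (intro sum.cong refl cone_ord) simp
    then show "apex_coeff n t' j v = apex_coeff n t j v"
      by (simp add: apex_coeff_def cone_stop cone_blocking_eq cone_ord cone_blocking)
  qed
  moreover have "(\<lambda>j. blocking j t') ` {..<stop n t'} = (\<lambda>j. blocking j t) ` {..<stop n t}"
    unfolding cone_stop using cone_blocking_eq by (intro image_cong) auto
  ultimately show ?thesis unfolding classifier_def by (simp only:)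
qed

lemma cone_weight: "n \<le> weight t' \<longleftrightarrow> n \<le> weight t"
  unfolding stop_less_iff[symmetric] cone_stop ..

text \<open>Below weight \<open>n\<close> all \<open>m\<close> orders are frozen, so cones stay
  inside \<open>heavy p\<close> for every \<open>p\<close>.\<close>

lemma cone_weight_eq: "weight t < n \<Longrightarrow> weight t' = weight t"
  using stop_less_iff[of n t] stop_le[of n t] cone_ord by (simp add: weight_def)

end

lemma finite_classifier: "finite (range (classifier n))"
proof (rule finite_subset)
  let ?B = "{a. \<forall>v. Poly_Mapping.lookup a v \<le> n * (\<Sum>j<m. Poly_Mapping.lookup (u j) v)}"
  show "range (classifier n) \<subseteq> ?B \<times> UNIV"
  proof (rule image_subsetI)
    fix t
    have "Poly_Mapping.lookup (fst (classifier n t)) v \<le> n * (\<Sum>j<m. Poly_Mapping.lookup (u j) v)" for v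
    proof (cases "\<exists>j<m. v \<in> supp j")
      case True
      then obtain j where j: "j < m" "v \<in> supp j" by blast
      have "apex_coeff n t j v \<le> n * Poly_Mapping.lookup (u j) v"
      proof (cases "j < stop n t")
        case True
        \<comment> \<open>The partial sum through \<open>j\<close> contains \<open>ord j t\<close>
          and is still smaller than \<open>n\<close>.\<close>
        have "ord j t + 1 \<le> n" using below_stop[OF True] by simp
        then have le: "(ord j t + 1) * Poly_Mapping.lookup (u j) v \<le> n * Poly_Mapping.lookup (u j) v"
          by (rule mult_right_mono) simp
        then show ?thesis
          using True blocking(2)[OF j(1), of t] \<open>ord j t + 1 \<le> n\<close> by (auto simp: apex_coeff_def)
      qed (auto simp: apex_coeff_def intro: mult_right_mono)
      also have "\<dots> \<le> n * (\<Sum>j<m. Poly_Mapping.lookup (u j) v)"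
        using j(1) by (intro mult_left_mono member_le_sum) auto
      finally show ?thesis by (simp add: lookup_classifier[OF j])
    next
      case False
      then show ?thesis using lookup_classifier_outside[of v n t] by auto
    qed
    then show "classifier n t \<in> ?B \<times> UNIV" by (simp add: mem_Times_iff)
  qed
  show "finite (?B \<times> (UNIV :: 'v set set))"
    by (intro finite_cartesian_product finite_bounded_exponents) simp
qed

lemma card_classifier: "card (snd (classifier n t)) + stop n t = CARD('v)"
  unfolding snd_classifier using stop_le[of n t] blocking(1)[of _ t] by (intro card_avoiding) auto

theorem sdepth_quotient:
  fixes M :: "(('v, 'k::field) mpoly, 'm, 'v \<Rightarrow> int) graded_module"
  assumes M: "monomial_module M \<phi> (heavy p) (heavy n)"
  shows "sdepth M = CARD('v) - m"
proof -
  interpret monomial_module M \<phi> "heavy p" "heavy n" by (rule M)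
  obtain D where D: "stanley_decomposition M D" "snd ` set D = snd ` classifier n ` (heavy p - heavy n)"
  proof -
    have "\<exists>D. stanley_decomposition M D \<and> snd ` set D = snd ` classifier n ` (heavy p - heavy n)"
    proof (rule stanley_decomposition_of_classifier)
      show "finite (classifier n ` (heavy p - heavy n))"
        by (rule finite_subset[OF _ finite_classifier]) auto
      show "t \<in> cone (fst (classifier n t)) (snd (classifier n t))" for t
        by (rule in_cone_classifier)
      show "t' \<in> heavy p - heavy n \<and> classifier n t' = classifier n t"
        if "t \<in> heavy p - heavy n" "t' \<in> cone (fst (classifier n t)) (snd (classifier n t))" for t t'
        using that cone_classifier[OF that(2)] cone_weight_eq[OF that(2)] by (simp add: heavy_def)
    qed
    then show thesis using that by blast
  qed
  show ?thesis
  proof (rule sdepth_eqI[OF D(1)])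
    fix Z assume "Z \<in> snd ` set D"
    then obtain t where "Z = snd (classifier n t)" unfolding D(2) by blast
    then show "CARD('v) - m \<le> card Z" using card_classifier[of n t] stop_le[of n t] by simp
  next
    fix E assume E: "stanley_decomposition M E"
    then obtain g Z where gZ: "(g, Z) \<in> set E"
      using stanley_decomposition_nonempty[OF E] by (metis list.set_sel(1) surj_pair)
    have "\<exists>v. v \<in> supp j - Z" if j: "j < m" for j
    proof -
      \<comment> \<open>The \<open>n\<close>-th power of generator \<open>j\<close> annihilates the
        quotient, so \<open>Z\<close> misses a variable of \<open>supp j\<close>. Over all
        \<open>j\<close> this excludes \<open>m\<close> different variables.\<close>
      let ?w = "comb (\<lambda>i. if i = j then n else 0)"
      have "\<not> Poly_Mapping.keys ?w \<subseteq> Z"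
      proof (rule stanley_decomposition_annihilator[OF E gZ])
        fix t
        have "weight ?w = n" using j by (simp add: weight_comb)
        then show "t + ?w \<in> heavy n" using weight_add_ge[of t ?w] by (simp add: heavy_def)
      qed
      moreover have "Poly_Mapping.keys ?w \<subseteq> supp j"
        using j by (auto simp: in_keys_iff lookup_comb split: if_splits)
      ultimately show ?thesis by blast
    qed
    then obtain w where w: "\<And>j. j < m \<Longrightarrow> w j \<in> supp j - Z" by metis
    then have "card (- w ` {..<m}) + m = CARD('v)" by (intro card_avoiding) auto
    moreover have "Z \<subseteq> - w ` {..<m}" using w by blast
    then have "card Z \<le> card (- w ` {..<m})" by (intro card_mono) auto
    ultimately show "\<exists>Z\<in>snd ` set E. card Z \<le> CARD('v) - m"
      using gZ by (intro bexI[of _ Z]) force+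
  qed
qed

text \<open>
  The minimal generators of the \<open>n\<close>-th power are apexes of distinct Stanley spaces. If all of these
  had dimension at least \<open>CARD('v) - m + 2\<close>, each would contain two of the minimal generators of the next power.
\<close>

theorem sdepth_power:
  fixes M :: "(('v, 'k::field) mpoly, 'm, 'v \<Rightarrow> int) graded_module"
  assumes M: "monomial_module M \<phi> (heavy n) {}" and n: "m \<le> n + 1"
  shows "sdepth M = CARD('v) - m + 1"
proof -
  interpret monomial_module M \<phi> "heavy n" "{}" by (rule M)
  obtain D where D: "stanley_decomposition M D" "snd ` set D = snd ` classifier n ` (heavy n - {})"
  proof -
    have "\<exists>D. stanley_decomposition M D \<and> snd ` set D = snd ` classifier n ` (heavy n - {})"
    proof (rule stanley_decomposition_of_classifier)
      show "finite (classifier n ` (heavy n - {}))"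
        by (rule finite_subset[OF _ finite_classifier]) auto
      show "t \<in> cone (fst (classifier n t)) (snd (classifier n t))" for t
        by (rule in_cone_classifier)
      show "t' \<in> heavy n - {} \<and> classifier n t' = classifier n t"
        if "t \<in> heavy n - {}" "t' \<in> cone (fst (classifier n t)) (snd (classifier n t))" for t t'
        using that cone_classifier[OF that(2)] cone_weight[OF that(2)] by (simp add: heavy_def)
    qed
    then show thesis using that by blast
  qed
  show ?thesis
  proof (rule sdepth_eqI[OF D(1)])
    fix Z assume "Z \<in> snd ` set D"
    then obtain t where t: "t \<in> heavy n" "Z = snd (classifier n t)" unfolding D(2) by blast
    then have "stop n t < m" using stop_less_iff[of n t] by (simp add: heavy_def)
    then show "CARD('v) - m + 1 \<le> card Z"
      using card_classifier[of n t] m_le_card unfolding t(2) by linarith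
  next
    fix E assume E: "stanley_decomposition M E"
    show "\<exists>Z\<in>snd ` set E. card Z \<le> CARD('v) - m + 1"
    proof (rule ccontr)
      assume no: "\<not> (\<exists>Z\<in>snd ` set E. card Z \<le> CARD('v) - m + 1)"
      let ?Z = "\<lambda>i. snd (E ! i)"
      \<comment> \<open>Avoids truncated subtraction: the number of variables missing from
        \<open>?Z i\<close>, plus 2, is at most \<open>m\<close>.\<close>
      have big: "CARD('v) + 2 \<le> card (?Z i) + m" if "i < length E" for i
      proof -
        have "?Z i \<in> snd ` set E" using that by simp
        then have "\<not> card (?Z i) \<le> CARD('v) - m + 1" using no by blast
        then show ?thesis using m_le_card by linarith
      qed
      obtain b where b: "\<And>i. i < length E \<Longrightarrow> b i \<in> heavy n"
        and cover: "\<And>t. t \<in> heavy n \<Longrightarrow> \<exists>i<length E. t \<in> cone (b i) (?Z i)"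
        and disj: "\<And>t i j. t \<in> heavy n \<Longrightarrow> i < length E \<Longrightarrow> j < length E \<Longrightarrow> i \<noteq> j \<Longrightarrow>
          t \<in> cone (b i) (?Z i) \<Longrightarrow> t \<notin> cone (b j) (?Z j)"
        using stanley_decomposition_cones[OF E] by (metis Diff_empty)
      \<comment> \<open>Exponent lists of the minimal generators of the \<open>N\<close>-th power;
        lists allow counting by stars and bars.\<close>
      define L where "L N = {l :: nat list. length l = m \<and> sum_list l = N}" for N
      have sumL: "(\<Sum>j<m. l ! j) = N" if "l \<in> L N" for l N
        using that sum_list_sum_nth[of l] by (auto simp: L_def atLeast0LessThan)
      have "\<exists>i. i < length E \<and> b i = comb ((!) l)" if l: "l \<in> L n" for l
      proof -
        have "comb ((!) l) \<in> heavy n" using sumL[OF l] by (simp add: heavy_def weight_comb)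
        then obtain i where i: "i < length E" "comb ((!) l) \<in> cone (b i) (?Z i)" using cover by blast
        \<comment> \<open>The apex divides the generator and itself lies in the \<open>n\<close>-th
          power, so minimality identifies the two.\<close>
        have "b i = comb ((!) l)"
          using i(2) by (intro comb_weight[OF sumL[OF l] b[OF i(1)]]) (simp add: cone_iff)
        then show ?thesis using i(1) by blast
      qed
      then obtain \<iota> where \<iota>: "\<And>l. l \<in> L n \<Longrightarrow> \<iota> l < length E" "\<And>l. l \<in> L n \<Longrightarrow> b (\<iota> l) = comb ((!) l)"
        by metis
      define S where "S l = {j. j < m \<and> supp j \<subseteq> ?Z (\<iota> l)}" for l
      \<comment> \<open>Each missing variable spoils at most one support, and at most
        \<open>m - 2\<close> variables are missing, so two supports lie entirely in the cone
        directions. Multiplying by either generator stays in the cone.\<close>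
      have card_S: "2 \<le> card (S l)" if l: "l \<in> L n" for l
      proof -
        have "\<forall>j. \<exists>v. j < m \<and> j \<notin> S l \<longrightarrow> v \<in> supp j - ?Z (\<iota> l)" by (auto simp: S_def)
        then obtain w where w: "\<And>j. j < m \<Longrightarrow> j \<notin> S l \<Longrightarrow> w j \<in> supp j - ?Z (\<iota> l)" by metis
        have "inj_on w ({..<m} - S l)"
        proof (rule inj_onI)
          fix i j assume "i \<in> {..<m} - S l" "j \<in> {..<m} - S l" "w i = w j"
          then show "i = j" using w[of i] w[of j] supp_unique[of i j "w i"] by auto
        qed
        then have "card ({..<m} - S l) \<le> card (- ?Z (\<iota> l))"
          using w by (intro card_inj_on_le[of w]) auto
        moreover have "card (- ?Z (\<iota> l)) = CARD('v) - card (?Z (\<iota> l))"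
          by (simp add: Compl_eq_Diff_UNIV card_Diff_subset)
        moreover have "card ({..<m} - S l) = m - card (S l)"
          by (subst card_Diff_subset) (auto simp: S_def)
        moreover have "card (?Z (\<iota> l)) \<le> CARD('v)" by (intro card_mono) auto
        ultimately show ?thesis using big[OF \<iota>(1)[OF l]] by linarith
      qed
      define next_gen where "next_gen = (\<lambda>(l, j). l[j := Suc (l ! j)])"
      have comb_next: "comb ((!) (l[j := Suc (l ! j)])) = comb ((!) l) + u j" if "length l = m" "j < m" for l j
      proof (rule poly_mapping_eqI)
        fix v
        have "(\<Sum>i<m. l[j := Suc (l ! j)] ! i * Poly_Mapping.lookup (u i) v) =
            (\<Sum>i<m. l ! i * Poly_Mapping.lookup (u i) v + (if i = j then Poly_Mapping.lookup (u j) v else 0))"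
          using that by (intro sum.cong refl) (auto simp: nth_list_update)
        then show "Poly_Mapping.lookup (comb ((!) (l[j := Suc (l ! j)]))) v = Poly_Mapping.lookup (comb ((!) l) + u j) v"
          using that by (simp add: lookup_comb lookup_add sum.distrib)
      qed
      have next_L: "l[j := Suc (l ! j)] \<in> L (Suc n)" if "l \<in> L n" "j < m" for l j
        using that by (simp add: L_def sum_list_update)
      have finL: "finite (L N)" for N
      proof -
        have "L N \<subseteq> {l. set l \<subseteq> {..N} \<and> length l = m}"
          using member_le_sum_list by (fastforce simp: L_def)
        then show ?thesis by (rule finite_subset) (simp add: finite_lists_length_eq)
      qed
      have in_cone: "comb ((!) (l[j := Suc (l ! j)])) \<in> cone (b (\<iota> l)) (?Z (\<iota> l))"
        if "l \<in> L n" "j \<in> S l" for l j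
      proof -
        have "comb ((!) (l[j := Suc (l ! j)])) = u j + b (\<iota> l)"
          using that comb_next[of l j] \<iota>(2)[of l] by (simp add: L_def S_def add.commute)
        then show ?thesis using that(2) by (auto simp: S_def cone_def)
      qed
      \<comment> \<open>A common successor would lie in the cones of both generators, so the cones
        agree, and hence their apexes.\<close>
      have "inj_on next_gen (Sigma (L n) S)"
      proof (rule inj_onI, clarify)
        fix l j l' j'
        assume l: "l \<in> L n" "j \<in> S l" "l' \<in> L n" "j' \<in> S l'" and eq: "next_gen (l, j) = next_gen (l', j')"
        have jm: "j < m" "j' < m" using l by (auto simp: S_def)
        let ?t = "comb ((!) (next_gen (l, j)))"
        have "next_gen (l, j) \<in> L (Suc n)" using next_L l jm by (simp add: next_gen_def)
        then have t: "?t \<in> heavy n" using sumL by (simp add: heavy_def weight_comb)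
        have "?t \<in> cone (b (\<iota> l)) (?Z (\<iota> l))" using in_cone l by (simp add: next_gen_def)
        moreover have "?t \<in> cone (b (\<iota> l')) (?Z (\<iota> l'))"
          using in_cone[OF l(3,4)] eq by (simp add: next_gen_def)
        ultimately have "\<iota> l = \<iota> l'" using disj[OF t] \<iota>(1) l by blast
        then have "comb ((!) l) = comb ((!) l')" using \<iota>(2) l by metis
        then have "l ! i = l' ! i" if "i < m" for i using ord_comb[OF that] by metis
        then have ll: "l = l'" using l by (intro nth_equalityI) (auto simp: L_def)
        have "length l = m" using l by (simp add: L_def)
        moreover have "l[j := Suc (l ! j)] ! j = l[j' := Suc (l ! j')] ! j"
          using eq ll by (simp add: next_gen_def)
        ultimately have "j = j'"
          using jm by (cases "j = j'") auto
        then show "l = l' \<and> j = j'" using ll by simp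
      qed
      moreover have "next_gen ` Sigma (L n) S \<subseteq> L (Suc n)"
        using next_L by (auto simp: next_gen_def S_def)
      ultimately have "card (Sigma (L n) S) \<le> card (L (Suc n))"
        using finL by (intro card_inj_on_le)
      moreover have "card (Sigma (L n) S) = (\<Sum>l\<in>L n. card (S l))"
        using finL by (intro card_SigmaI) (auto simp: S_def)
      moreover have "(\<Sum>l\<in>L n. 2) \<le> (\<Sum>l\<in>L n. card (S l))"
        using card_S by (rule sum_mono)
      ultimately have le: "2 * card (L n) \<le> card (L (Suc n))" by simp
      have cardL: "card (L N) = (N + m - 1) choose N" for N
        unfolding L_def by (rule card_length_sum_list)
      have "Suc n * card (L (Suc n)) = (n + m) * card (L n)"
        using Suc_times_binomial[of n "n + m - 1"] m_pos by (simp add: cardL)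
      moreover have "Suc n * (2 * card (L n)) \<le> Suc n * card (L (Suc n))"
        using le by (rule mult_le_mono2)
      moreover have "0 < card (L n)" using m_pos by (simp add: cardL)
      \<comment> \<open>Doubling would mean that the growth factor \<open>(n + m) / (n + 1)\<close>
        is at least 2, which fails for \<open>m \<le> n + 1\<close>.\<close>
      ultimately have "Suc n * 2 \<le> n + m"
        by (metis mult.assoc mult_le_cancel2)
      then show False using n by simp
    qed
  qed
qed

end

section \<open>Krull dimension\<close>

context ideal
begin

text \<open>An ideal containing \<open>I\<close> is a union of cosets of \<open>I\<close>, so the
  image in the quotient determines it.\<close>

lemma rcos_mem_image_iff:
  assumes P: "ideal P R" "I \<subseteq> P" and r: "r \<in> carrier R"
  shows "I +> r \<in> (+>) I ` P \<longleftrightarrow> r \<in> P"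
proof
  assume "I +> r \<in> (+>) I ` P"
  then obtain p where p: "p \<in> P" "I +> r = I +> p" by blast
  interpret P: ideal P R by (rule P(1))
  have pc: "p \<in> carrier R" by (rule P.Icarr[OF p(1)])
  have "r \<ominus> p \<in> P"
    using quotient_eq_iff_same_a_r_cos[OF is_ideal r pc] p(2) P(2) by blast
  then have "(r \<ominus> p) \<oplus> p \<in> P" using p(1) by (rule P.a_closed)
  then show "r \<in> P" using r pc by (simp add: minus_eq a_assoc l_neg)
qed blast

lemma primeideal_image_quotient:
  assumes "primeideal P R" "I \<subseteq> P"
  shows "primeideal ((+>) I ` P) (R Quot I)"
proof -
  interpret P: primeideal P R by (rule assms(1))
  show ?thesis
  proof (rule primeidealI)
    show "ideal ((+>) I ` P) (R Quot I)"
      by (rule ring_ideal_imp_quot_ideal[OF is_ideal P.is_ideal])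
    show "cring (R Quot I)"
      by (rule quotient_is_cring[OF P.is_cring])
    show "carrier (R Quot I) \<noteq> (+>) I ` P"
    proof
      assume eq: "carrier (R Quot I) = (+>) I ` P"
      have "I +> \<one> \<in> carrier (R Quot I)"
        by (simp add: FactRing_def a_rcosetsI[OF a_subset])
      then have "\<one> \<in> P"
        unfolding eq using rcos_mem_image_iff[OF P.is_ideal assms(2), of \<one>] by simp
      then show False using P.one_imp_carrier P.I_notcarr by blast
    qed
    fix a b assume ab: "a \<in> carrier (R Quot I)" "b \<in> carrier (R Quot I)"
      "a \<otimes>\<^bsub>R Quot I\<^esub> b \<in> (+>) I ` P"
    then obtain x y where xy: "x \<in> carrier R" "a = I +> x" "y \<in> carrier R" "b = I +> y"
      by (auto simp: FactRing_simps)
    have "I +> (x \<otimes> y) \<in> (+>) I ` P"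
      using ab(3) xy by (simp add: FactRing_def rcoset_mult_add)
    then have "x \<otimes> y \<in> P"
      using rcos_mem_image_iff[OF P.is_ideal assms(2), of "x \<otimes> y"] xy by simp
    then show "a \<in> (+>) I ` P \<or> b \<in> (+>) I ` P"
      using P.I_prime[OF xy(1,3)] xy by blast
  qed
qed

text \<open>Preimages and images of primes under the quotient map preserve strict inclusions, so
  chains can be studied in \<open>R\<close> itself.\<close>

lemma krull_dim_quotient:
  assumes "cring R"
  shows "krull_dim (R Quot I) =
    Sup {enat n | n. \<exists>p. (\<forall>i\<le>n. primeideal (p i) R \<and> I \<subseteq> p i) \<and> (\<forall>i<n. p i \<subset> p (Suc i))}"
proof -
  have zero_eq: "\<zero>\<^bsub>R Quot I\<^esub> = I" by (simp add: FactRing_def)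
  have coset: "\<exists>r\<in>carrier R. c = I +> r" if "c \<in> carrier (R Quot I)" for c
    using that by (auto simp: FactRing_simps)
  have "(\<exists>q. (\<forall>i\<le>n. primeideal (q i) (R Quot I)) \<and> (\<forall>i<n. q i \<subset> q (Suc i))) \<longleftrightarrow>
      (\<exists>p. (\<forall>i\<le>n. primeideal (p i) R \<and> I \<subseteq> p i) \<and> (\<forall>i<n. p i \<subset> p (Suc i)))" for n :: nat
  proof (intro iffI; elim exE conjE)
    fix q assume q: "\<forall>i\<le>n. primeideal (q i) (R Quot I)" "\<forall>i<n. q i \<subset> q (Suc i)"
    define p where "p i = {r \<in> carrier R. I +> r \<in> q i}" for i
    have "primeideal (p i) R \<and> I \<subseteq> p i" if i: "i \<le> n" for i
    proof
      show "primeideal (p i) R"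
        using ring_hom_ring.primeideal_vimage[OF rcos_ring_hom_ring assms q(1)[rule_format, OF i]] unfolding p_def .
      have "ideal (q i) (R Quot I)" using q(1) i by (simp add: primeideal_def)
      then have "I \<in> q i"
        using additive_subgroup.zero_closed[OF ideal.axioms(1)] zero_eq by metis
      then show "I \<subseteq> p i"
        using a_rcos_const Icarr by (auto simp: p_def)
    qed
    moreover have "p i \<subset> p (Suc i)" if i: "i < n" for i
    proof -
      obtain c where c: "c \<in> q (Suc i)" "c \<notin> q i" using q(2) i by blast
      have "ideal (q (Suc i)) (R Quot I)" using q(1) i by (simp add: primeideal_def)
      then have "c \<in> carrier (R Quot I)" using c(1) by (rule ideal.Icarr)
      then obtain r where "r \<in> carrier R" "c = I +> r" using coset by blast
      then have "r \<in> p (Suc i) - p i" using c by (auto simp: p_def)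
      moreover have "p i \<subseteq> p (Suc i)" using q(2) i by (auto simp: p_def)
      ultimately show ?thesis by blast
    qed
    ultimately show "\<exists>p. (\<forall>i\<le>n. primeideal (p i) R \<and> I \<subseteq> p i) \<and> (\<forall>i<n. p i \<subset> p (Suc i))"
      by blast
  next
    fix p assume p: "\<forall>i\<le>n. primeideal (p i) R \<and> I \<subseteq> p i" "\<forall>i<n. p i \<subset> p (Suc i)"
    have "primeideal ((+>) I ` p i) (R Quot I)" if "i \<le> n" for i
      using primeideal_image_quotient p(1) that by blast
    moreover have "(+>) I ` p i \<subset> (+>) I ` p (Suc i)" if i: "i < n" for i
    proof -
      obtain r where r: "r \<in> p (Suc i)" "r \<notin> p i" using p(2) i by blast
      interpret P: primeideal "p i" R using p i by (meson less_imp_le)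
      interpret P': primeideal "p (Suc i)" R using p i by (metis Suc_leI)
      have "I \<subseteq> p i" using p i by (meson less_imp_le)
      then have "I +> r \<notin> (+>) I ` p i"
        using rcos_mem_image_iff[OF P.is_ideal _ P'.Icarr[OF r(1)]] r(2) by blast
      moreover have "I +> r \<in> (+>) I ` p (Suc i)" using r(1) by blast
      moreover have "(+>) I ` p i \<subseteq> (+>) I ` p (Suc i)" using p(2) i by blast
      ultimately show ?thesis by blast
    qed
    ultimately show "\<exists>q. (\<forall>i\<le>n. primeideal (q i) (R Quot I)) \<and> (\<forall>i<n. q i \<subset> q (Suc i))"
      by (intro exI[of _ "\<lambda>i. (+>) I ` p i"]) blast
  qed
  then show ?thesis unfolding krull_dim_def by simp
qed

end

lemma primeideal_polynomial_ring_iff: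
  fixes P :: "('v, 'k::field) mpoly set"
  shows "primeideal P polynomial_ring \<longleftrightarrow>
    ideal P polynomial_ring \<and> 1 \<notin> P \<and> (\<forall>p q. p * q \<in> P \<longrightarrow> p \<in> P \<or> q \<in> P)"
proof (intro iffI conjI allI impI)
  assume "primeideal P polynomial_ring"
  then interpret primeideal P "polynomial_ring :: ('v, 'k) mpoly ring" .
  show "ideal P polynomial_ring" by (rule is_ideal)
  show "1 \<notin> P" using one_imp_carrier I_notcarr by simp blast
  show "p \<in> P \<or> q \<in> P" if "p * q \<in> P" for p q using I_prime[of p q] that by simp
next
  assume P: "ideal P polynomial_ring \<and> 1 \<notin> P \<and> (\<forall>p q. p * q \<in> P \<longrightarrow> p \<in> P \<or> q \<in> P)"
  show "primeideal P polynomial_ring"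
    by (rule primeidealI) (use P cring_polynomial_ring in auto)
qed

section \<open>Algebraic independence along chains of primes\<close>

abbreviation const :: "'k::field \<Rightarrow> ('v, 'k) mpoly"
  where "const c \<equiv> Poly_Mapping.single 0 c"

definition powers :: "('v, 'k::field) mpoly list \<Rightarrow> nat list \<Rightarrow> ('v, 'k) mpoly"
  where "powers xs es = prod_list (map2 (\<lambda>x k. x ^ k) xs es)"

lemma powers_Nil [simp]: "powers [] es = 1"
  and powers_Cons [simp]: "powers (x # xs) (k # es) = x ^ k * powers xs es"
  by (simp_all add: powers_def)

text \<open>
  Elements that witness the strictness of a chain of primes are algebraically independent modulo the
  smallest prime: divide a relation by the least power of the first element that occurs and reduce
  modulo the next prime.
\<close>

lemma chain_algebraically_independent:
  fixes P :: "nat \<Rightarrow> ('v, 'k::field) mpoly set"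
  assumes "\<And>i. i \<le> length xs \<Longrightarrow> primeideal (P i) polynomial_ring"
    and "\<And>i. i < length xs \<Longrightarrow> P i \<subseteq> P (Suc i) \<and> xs ! i \<in> P (Suc i) - P i"
    and "finite F" "\<And>es. es \<in> F \<Longrightarrow> length es = length xs"
    and "(\<Sum>es\<in>F. const (c es) * powers xs es) \<in> P 0"
    and "es \<in> F"
  shows "c es = 0"
  using assms
proof (induction xs arbitrary: P F c es)
  case Nil
  have prime: "ideal (P 0) polynomial_ring" "1 \<notin> P 0"
    using Nil.prems(1)[of 0] by (simp_all add: primeideal_polynomial_ring_iff)
  \<comment> \<open>With no elements left the relation is a constant, and a nonzero constant would
    make the prime contain 1.\<close>
  have "F = {[]}" using Nil.prems(4,6) by auto
  then have c: "const (c []) \<in> P 0" using Nil.prems(5) by simp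
  have "c [] = 0"
  proof (rule ccontr)
    assume "c [] \<noteq> 0"
    have "const (inverse (c [])) * const (c []) \<in> P 0"
      using prime(1) c by (simp add: ideal_polynomial_ring_iff del: mult_single)
    then show False using \<open>c [] \<noteq> 0\<close> prime(2) by (simp add: mult_single)
  qed
  then show ?case using Nil.prems(4)[OF Nil.prems(6)] by simp
next
  case (Cons x xs)
  have P0: "ideal (P 0) polynomial_ring" "\<And>p q. p * q \<in> P 0 \<Longrightarrow> p \<in> P 0 \<or> q \<in> P 0"
    using Cons.prems(1)[of 0] by (auto simp: primeideal_polynomial_ring_iff)
  have P1: "ideal (P 1) polynomial_ring"
    using Cons.prems(1)[of 1] by (auto simp: primeideal_polynomial_ring_iff)
  have one: "1 \<notin> P 0"
    using Cons.prems(1)[of 0] by (auto simp: primeideal_polynomial_ring_iff)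
  have x: "P 0 \<subseteq> P 1" "x \<in> P 1" "x \<notin> P 0" using Cons.prems(2)[of 0] by auto
  define F0 where "F0 = {es \<in> F. c es \<noteq> 0}"
  have "F0 = {}"
  proof (rule ccontr)
    assume ne: "F0 \<noteq> {}"
    have finF0: "finite F0" using Cons.prems(3) by (simp add: F0_def)
    define k where "k = Min (hd ` F0)"
    have k_le: "k \<le> hd es" if "es \<in> F0" for es
      using that finF0 by (simp add: k_def)
    have "k \<in> hd ` F0" unfolding k_def using ne finF0 by (intro Min_in) auto
    then obtain es0 where es0: "es0 \<in> F0" "hd es0 = k" by blast
    have split: "es = hd es # tl es" if "es \<in> F0" for es
      using Cons.prems(4)[of es] that by (cases es) (auto simp: F0_def)
    let ?g = "\<lambda>es. const (c es) * (x ^ (hd es - k) * powers xs (tl es))"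
    have "(\<Sum>es\<in>F. const (c es) * powers (x # xs) es) = (\<Sum>es\<in>F0. const (c es) * powers (x # xs) es)"
      using Cons.prems(3) by (intro sum.mono_neutral_right) (auto simp: F0_def)
    also have "\<dots> = (\<Sum>es\<in>F0. x ^ k * ?g es)"
    proof (intro sum.cong refl)
      fix es assume es: "es \<in> F0"
      have "powers (x # xs) es = x ^ hd es * powers xs (tl es)"
        by (subst split[OF es]) (rule powers_Cons)
      also have "x ^ hd es = x ^ k * x ^ (hd es - k)"
        using k_le[OF es] by (simp flip: power_add)
      finally show "const (c es) * powers (x # xs) es = x ^ k * ?g es"
        by (simp only: ac_simps)
    qed
    also have "\<dots> = x ^ k * (\<Sum>es\<in>F0. ?g es)" by (simp add: sum_distrib_left)
    finally have "x ^ k * (\<Sum>es\<in>F0. ?g es) \<in> P 0" using Cons.prems(5) by simp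
    \<comment> \<open>Primality cancels the common factor, and the quotient lies in
      \<open>P 0\<close>, hence in \<open>P 1\<close>.\<close>
    moreover have "x ^ k \<notin> P 0" for k
      by (induction k) (use P0(2) x(3) one in auto)
    ultimately have "(\<Sum>es\<in>F0. ?g es) \<in> P 1" using P0(2) x(1) by blast
    define F1 where "F1 = {es \<in> F0. hd es = k}"
    have fin1: "finite F1" using finF0 by (simp add: F1_def)
    have add1: "p + q \<in> P 1" if "p \<in> P 1" "q \<in> P 1" for p q
      using P1 that by (simp add: ideal_polynomial_ring_iff)
    have mult1: "r * p \<in> P 1" if "p \<in> P 1" for r p
      using P1 that by (simp add: ideal_polynomial_ring_iff)
    have zero1: "0 \<in> P 1" using P1 by (simp add: ideal_polynomial_ring_iff)
    \<comment> \<open>A larger first exponent leaves a factor \<open>x\<close>, which lies in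
      \<open>P 1\<close>; only terms with the minimal exponent survive modulo
      \<open>P 1\<close>.\<close>
    have rest: "?g es \<in> P 1" if es: "es \<in> F0 - F1" for es
    proof -
      obtain d where "hd es - k = Suc d" using es k_le[of es] by (cases "hd es - k") (auto simp: F1_def)
      then have "?g es = (const (c es) * x ^ d * powers xs (tl es)) * x"
        by (simp add: ac_simps)
      then show ?thesis using mult1[OF x(2)] by metis
    qed
    have "(\<Sum>es\<in>F0 - F1. ?g es) \<in> P 1"
    proof -
      have "(\<Sum>es\<in>G. ?g es) \<in> P 1" if "finite G" "G \<subseteq> F0 - F1" for G
        using that
      proof (induction G rule: finite_induct)
        case (insert es G)
        have "(\<Sum>es\<in>insert es G. ?g es) = ?g es + (\<Sum>es\<in>G. ?g es)"
          using insert.hyps by (rule sum.insert)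
        moreover have "\<dots> \<in> P 1"
          using insert by (intro add1 rest insert.IH) auto
        ultimately show ?case by (simp only:)
      qed (use zero1 in simp)
      then show ?thesis using finF0 by blast
    qed
    then have "- (\<Sum>es\<in>F0 - F1. ?g es) \<in> P 1" using mult1[of _ "-1"] by simp
    moreover have "(\<Sum>es\<in>F0. ?g es) = (\<Sum>es\<in>F0 - F1. ?g es) + (\<Sum>es\<in>F1. ?g es)"
      using finF0 by (intro sum.subset_diff) (auto simp: F1_def)
    ultimately have sum1: "(\<Sum>es\<in>F1. ?g es) \<in> P 1"
      using add1[OF \<open>(\<Sum>es\<in>F0. ?g es) \<in> P 1\<close>] by fastforce
    have inj: "inj_on tl F1"
    proof (rule inj_onI)
      fix es es' assume "es \<in> F1" "es' \<in> F1" "tl es = tl es'"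
      then show "es = es'" using split[of es] split[of es'] by (simp add: F1_def)
    qed
    have "(\<Sum>es\<in>tl ` F1. const (c (k # es)) * powers xs es) = (\<Sum>es\<in>F1. ?g es)"
      unfolding sum.reindex[OF inj] comp_def
    proof (intro sum.cong refl)
      fix es assume "es \<in> F1"
      then have "es \<in> F0" "hd es = k" by (simp_all add: F1_def)
      then have "k # tl es = es" using split[of es] by simp
      then show "const (c (k # tl es)) * powers xs (tl es) = ?g es" using \<open>hd es = k\<close> by simp
    qed
    then have *: "(\<Sum>es\<in>tl ` F1. const (c (k # es)) * powers xs es) \<in> P (Suc 0)"
      using sum1 by simp
    have es0': "es0 \<in> F1" using es0 by (simp add: F1_def)
    have "c (k # tl es0) = 0"
    proof (rule Cons.IH[of "\<lambda>i. P (Suc i)" "tl ` F1" "\<lambda>es. c (k # es)", OF _ _ _ _ *])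
      show "primeideal (P (Suc i)) polynomial_ring" if "i \<le> length xs" for i
        using Cons.prems(1)[of "Suc i"] that by simp
      show "P (Suc i) \<subseteq> P (Suc (Suc i)) \<and> xs ! i \<in> P (Suc (Suc i)) - P (Suc i)" if "i < length xs" for i
        using Cons.prems(2)[of "Suc i"] that by simp
      show "finite (tl ` F1)" using fin1 by simp
      show "length es = length xs" if "es \<in> tl ` F1" for es
        using that Cons.prems(4) by (fastforce simp: F1_def F0_def)
      show "tl es0 \<in> tl ` F1" using es0' by blast
    qed
    moreover have "k # tl es0 = es0" using split[OF es0(1)] es0(2) by simp
    ultimately show False using es0(1) by (simp add: F0_def)
  qed
  then show ?case using Cons.prems(6) by (auto simp: F0_def)
qed

text \<open>A box of exponents: bounds add under multiplication, and the monomials in a set of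
  variables are counted by a plain power.\<close>

definition exponents_le :: "nat \<Rightarrow> ('v \<Rightarrow>\<^sub>0 nat) set"
  where "exponents_le B = {t. \<forall>v. Poly_Mapping.lookup t v \<le> B}"

lemma polys_on_exponents_le_mult:
  assumes "p \<in> polys_on (exponents_le B)" "q \<in> polys_on (exponents_le C)"
  shows "p * q \<in> polys_on (exponents_le (B + C))"
  unfolding polys_on_def
proof (intro CollectI subsetI)
  fix t assume "t \<in> Poly_Mapping.keys (p * q)"
  then obtain a b where "t = a + b" "a \<in> exponents_le B" "b \<in> exponents_le C"
    using keys_mult[of p q] assms unfolding polys_on_def by blast
  then show "t \<in> exponents_le (B + C)" by (auto simp: exponents_le_def lookup_add intro!: add_mono)
qed

lemma polys_on_exponents_le_mono: "B \<le> C \<Longrightarrow> polys_on (exponents_le B) \<subseteq> polys_on (exponents_le C)"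
  by (rule polys_on_mono) (auto simp: exponents_le_def intro: order_trans)

lemma one_in_polys_on_exponents_le: "(1 :: ('v, 'k::field) mpoly) \<in> polys_on (exponents_le B)"
  by (simp add: polys_on_def exponents_le_def)

lemma polys_on_exponents_le_power:
  "p \<in> polys_on (exponents_le B) \<Longrightarrow> p ^ k \<in> polys_on (exponents_le (k * B))"
  by (induction k) (auto intro: polys_on_exponents_le_mult one_in_polys_on_exponents_le)

lemma powers_in_polys_on:
  assumes "\<And>x. x \<in> set xs \<Longrightarrow> x \<in> polys_on (exponents_le B)"
    and "length es = length xs" "\<And>k. k \<in> set es \<Longrightarrow> k \<le> N"
  shows "powers xs es \<in> polys_on (exponents_le (length xs * (N * B)))"
  using assms(2,1,3)
proof (induction es xs rule: list_induct2)
  case (Cons k es x xs)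
  have "x ^ k \<in> polys_on (exponents_le (k * B))"
    using Cons.prems by (intro polys_on_exponents_le_power) simp
  also have "\<dots> \<subseteq> polys_on (exponents_le (N * B))"
    using Cons.prems by (intro polys_on_exponents_le_mono mult_right_mono) auto
  finally show ?case
    using Cons polys_on_exponents_le_mult[of "x ^ k" "N * B" "powers xs es" "length xs * (N * B)"] by simp
qed (simp add: one_in_polys_on_exponents_le)

lemma finite_polys_exponents_bound:
  fixes xs :: "('v::finite, 'k::field) mpoly list"
  obtains B where "\<And>x. x \<in> set xs \<Longrightarrow> x \<in> polys_on (exponents_le B)"
proof -
  let ?T = "(\<lambda>(t, v). Poly_Mapping.lookup t v) ` ((\<Union>x\<in>set xs. Poly_Mapping.keys x) \<times> UNIV)"
  have "finite ?T" by auto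
  then have "\<forall>b\<in>?T. b \<le> Max ?T" by simp
  then have "x \<in> polys_on (exponents_le (Max ?T))" if "x \<in> set xs" for x
    using that unfolding polys_on_def exponents_le_def by blast
  then show thesis by (rule that)
qed

lemma card_exponents_le:
  fixes V :: "'v::finite set"
  shows "card {t \<in> exponents_le B. Poly_Mapping.keys t \<subseteq> V} \<le> (B + 1) ^ card V"
proof -
  let ?X = "{t \<in> exponents_le B. Poly_Mapping.keys t \<subseteq> V}"
  have "card ?X \<le> card (PiE V (\<lambda>_. {..B}))"
  proof (rule card_inj_on_le)
    show "inj_on (\<lambda>t. restrict (Poly_Mapping.lookup t) V) ?X"
    proof (rule inj_onI, rule poly_mapping_eqI)
      fix t t' v assume t: "t \<in> ?X" "t' \<in> ?X"
        "restrict (Poly_Mapping.lookup t) V = restrict (Poly_Mapping.lookup t') V"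
      show "Poly_Mapping.lookup t v = Poly_Mapping.lookup t' v"
      proof (cases "v \<in> V")
        case True
        then show ?thesis using fun_cong[OF t(3), of v] by simp
      next
        case False
        then have "v \<notin> Poly_Mapping.keys t" "v \<notin> Poly_Mapping.keys t'" using t by auto
        then show ?thesis by (simp add: in_keys_iff)
      qed
    qed
    show "(\<lambda>t. restrict (Poly_Mapping.lookup t) V) ` ?X \<subseteq> PiE V (\<lambda>_. {..B})"
      by (auto simp: exponents_le_def)
  qed (auto intro: finite_PiE)
  also have "\<dots> = (B + 1) ^ card V" by (simp add: card_PiE)
  finally show ?thesis .
qed

text \<open>
  The number \<open>N ^ (card V + 1)\<close> of candidate products eventually exceeds the number of monomials in
  the variables \<open>V\<close> that they involve.
\<close>

lemma algebraically_dependent_modulo: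
  fixes xs :: "('v::finite, 'k::field) mpoly list"
  assumes len: "length xs = card V + 1"
  obtains F c es where "finite F" "\<And>es. es \<in> F \<Longrightarrow> length es = length xs" "es \<in> F" "c es \<noteq> 0"
    "restrict_poly {t. Poly_Mapping.keys t \<subseteq> V} (\<Sum>es\<in>F. const (c es) * powers xs es) = 0"
proof -
  let ?d = "card V" and ?\<pi> = "restrict_poly {t. Poly_Mapping.keys t \<subseteq> V} :: ('v, 'k) mpoly \<Rightarrow> _"
  obtain B where B: "\<And>x. x \<in> set xs \<Longrightarrow> x \<in> polys_on (exponents_le B)"
    using finite_polys_exponents_bound[of xs] by blast
  \<comment> \<open>Chosen so that \<open>C + 1 \<le> E * N\<close> and \<open>E ^ ?d < N\<close>;
    then \<open>(C + 1) ^ ?d < N ^ (?d + 1)\<close>, fewer monomials than products.\<close>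
  define E where "E = length xs * B + 1"
  define N where "N = E ^ ?d + 1"
  define C where "C = length xs * (N * B)"
  define F where "F = {es :: nat list. set es \<subseteq> {..<N} \<and> length es = length xs}"
  have finF: "finite F" unfolding F_def by (rule finite_lists_length_eq) simp
  have cardF: "card F = N ^ (?d + 1)"
    unfolding F_def using len by (subst card_lists_length_eq) auto
  define f where "f es = ?\<pi> (powers xs es)" for es
  define T where "T = {t \<in> exponents_le C. Poly_Mapping.keys t \<subseteq> V}"
  have "finite T"
    using finite_bounded_exponents[of "\<lambda>_. C"] by (auto simp: T_def exponents_le_def)
  have f_in: "f es \<in> polys_on T" if "es \<in> F" for es
  proof -
    have "powers xs es \<in> polys_on (exponents_le C)"
      unfolding C_def using that B by (intro powers_in_polys_on) (auto simp: F_def less_imp_le)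
    then show ?thesis
      by (auto simp: f_def polys_on_def T_def lookup_restrict_poly in_keys_iff[of _ "restrict_poly _ _"]
          in_keys_iff[of _ "powers xs es"] subset_iff split: if_splits)
  qed
  have \<pi>_const: "?\<pi> (const a * p) = const a * ?\<pi> p" for a p
    by (rule poly_mapping_eqI)
      (simp add: lookup_restrict_poly map.rep_eq when_def flip: mult_map_scale_conv_mult)
  have \<pi>_sum: "?\<pi> (\<Sum>es\<in>F. const (c es) * powers xs es) = (\<Sum>es\<in>F. const (c es) * f es)" for c
    by (simp add: restrict_poly_sum \<pi>_const f_def)
  have "\<exists>c. (\<exists>es\<in>F. c es \<noteq> 0) \<and> (\<Sum>es\<in>F. const (c es) * f es) = 0"
  proof (cases "inj_on f F")
    \<comment> \<open>Linear dependence concerns the set of values, so two products with equal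
      restriction need their own relation, their difference.\<close>
    case False
    then obtain a b where ab: "a \<in> F" "b \<in> F" "a \<noteq> b" "f a = f b" by (auto simp: inj_on_def)
    let ?c = "\<lambda>es. if es = a then 1 else if es = b then - 1 else (0 :: 'k)"
    have "(\<Sum>es\<in>F. const (?c es) * f es) = (\<Sum>es\<in>{a, b}. const (?c es) * f es)"
      using ab finF by (intro sum.mono_neutral_right) auto
    also have "\<dots> = 0" using ab by (simp add: single_uminus)
    finally show ?thesis using ab(1) by (intro exI[of _ ?c]) auto
  next
    case True
    interpret vs: vector_space "\<lambda>a (p :: ('v, 'k) mpoly). const a * p"
      by unfold_locales (simp_all add: algebra_simps single_add mult_single flip: mult.assoc)
    have span: "f ` F \<subseteq> vs.span (monomial ` T)"
    proof
      fix p assume "p \<in> f ` F"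
      then have p: "p \<in> polys_on T" using f_in by blast
      have "(\<Sum>t\<in>Poly_Mapping.keys p. const (Poly_Mapping.lookup p t) * monomial t) \<in> vs.span (monomial ` T)"
        using p by (intro vs.span_sum vs.span_scale vs.span_base) (auto simp: polys_on_def)
      also have "(\<Sum>t\<in>Poly_Mapping.keys p. const (Poly_Mapping.lookup p t) * monomial t) = p"
        by (subst (4) poly_mapping_eq_sum_single) (simp add: monomial_def mult_single)
      finally show "p \<in> vs.span (monomial ` T)" .
    qed
    have dep: "vs.dependent (f ` F)"
    proof (rule ccontr)
      assume "vs.independent (f ` F)"
      then have "card (f ` F) \<le> card (monomial ` T :: ('v, 'k) mpoly set)"
        using vs.independent_span_bound[OF _ _ span] \<open>finite T\<close> by blast
      also have "\<dots> \<le> card T" using \<open>finite T\<close> by (rule card_image_le)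
      also have "\<dots> \<le> (C + 1) ^ ?d" unfolding T_def by (rule card_exponents_le)
      also have "\<dots> \<le> (E * N) ^ ?d"
        by (rule power_mono) (simp_all add: C_def E_def N_def algebra_simps)
      also have "\<dots> < N * N ^ ?d"
        unfolding power_mult_distrib by (rule mult_strict_right_mono) (simp_all add: N_def)
      finally show False using card_image[OF True] cardF by simp
    qed
    then obtain a where a: "\<exists>v\<in>f ` F. a v \<noteq> 0" "(\<Sum>v\<in>f ` F. const (a v) * v) = 0"
      using vs.dependent_finite[of "f ` F"] finF by blast
    have "(\<Sum>es\<in>F. const (a (f es)) * f es) = 0"
      using a(2) by (simp add: sum.reindex[OF True])
    then show ?thesis using a(1) by (intro exI[of _ "\<lambda>es. a (f es)"]) auto
  qed
  then obtain c es where c: "es \<in> F" "c es \<noteq> 0" "(\<Sum>es\<in>F. const (c es) * f es) = 0" by blast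
  show thesis
  proof (rule that[where F = F and c = c, OF finF _ c(1,2)])
    show "length es = length xs" if "es \<in> F" for es using that by (simp add: F_def)
    show "?\<pi> (\<Sum>es\<in>F. const (c es) * powers xs es) = 0" unfolding \<pi>_sum by (rule c(3))
  qed
qed

section \<open>Variables in prime ideals and the length of prime chains\<close>

abbreviation var :: "'v \<Rightarrow> ('v \<Rightarrow>\<^sub>0 nat)"
  where "var v \<equiv> Poly_Mapping.single v 1"

lemma exponent_split_var:
  fixes t :: "'v \<Rightarrow>\<^sub>0 nat"
  assumes "v \<in> Poly_Mapping.keys t"
  shows "t = (t - var v) + var v"
  using assms by (intro poly_mapping_eqI) (auto simp: lookup_add lookup_minus lookup_single when_def in_keys_iff)

text \<open>Induction on the degree: split off one variable and use primality.\<close>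

lemma prime_contains_variable:
  fixes P :: "('v::finite, 'k::field) mpoly set"
  assumes P: "primeideal P polynomial_ring" and "monomial t \<in> P"
  shows "\<exists>v\<in>Poly_Mapping.keys t. monomial (var v) \<in> P"
  using assms(2)
proof (induction "\<Sum>v\<in>UNIV. Poly_Mapping.lookup t v" arbitrary: t rule: less_induct)
  case less
  have "1 \<notin> P" and prime: "\<And>p q. p * q \<in> P \<Longrightarrow> p \<in> P \<or> q \<in> P"
    using P by (auto simp: primeideal_polynomial_ring_iff)
  then have "t \<noteq> 0" using less.prems by (auto simp: monomial_def)
  then obtain v where v: "v \<in> Poly_Mapping.keys t" by (metis all_not_in_conv keys_eq_empty)
  have "monomial (t - var v) * monomial (var v) \<in> P"
    using less.prems exponent_split_var[OF v] by (metis monomial_add)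
  then consider "monomial (t - var v) \<in> P" | "monomial (var v) \<in> P" using prime by blast
  then show ?case
  proof cases
    case 1
    have "(\<Sum>w\<in>UNIV. Poly_Mapping.lookup (t - var v) w) < (\<Sum>w\<in>UNIV. Poly_Mapping.lookup t w)"
      using v by (intro sum_strict_mono_ex1)
        (auto simp: lookup_minus lookup_single when_def in_keys_iff intro!: bexI[of _ v])
    then obtain w where "w \<in> Poly_Mapping.keys (t - var v)" "monomial (var w) \<in> P"
      using less.hyps 1 by blast
    then show ?thesis by (auto simp: in_keys_iff lookup_minus intro!: bexI[of _ w])
  qed (use v in blast)
qed

text \<open>With more than \<open>card V\<close> steps, \<open>card V + 1\<close> separating
  elements satisfy a relation once the variables outside \<open>V\<close> are set to zero. These
  variables lie in \<open>P 0\<close>, so the relation holds modulo \<open>P 0\<close>, against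
  algebraic independence.\<close>

lemma prime_chain_length_le:
  fixes P :: "nat \<Rightarrow> ('v::finite, 'k::field) mpoly set"
  assumes prime: "\<And>i. i \<le> n \<Longrightarrow> primeideal (P i) polynomial_ring"
    and strict: "\<And>i. i < n \<Longrightarrow> P i \<subset> P (Suc i)"
    and vars: "\<And>w. w \<in> - V \<Longrightarrow> monomial (var w) \<in> P 0"
  shows "n \<le> card V"
proof (rule ccontr)
  assume "\<not> n \<le> card V"
  then have n: "card V + 1 \<le> n" by simp
  have "\<forall>i. \<exists>x. i < n \<longrightarrow> x \<in> P (Suc i) - P i" using strict by blast
  then obtain x where x: "\<And>i. i < n \<Longrightarrow> x i \<in> P (Suc i) - P i" by metis
  define xs where "xs = map x [0..<card V + 1]"
  have len: "length xs = card V + 1" by (simp add: xs_def)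
  have nth: "xs ! i = x i" if "i < length xs" for i
    using that by (simp add: xs_def del: upt_Suc)
  obtain F c es where F: "finite F" "\<And>es. es \<in> F \<Longrightarrow> length es = length xs" "es \<in> F" "c es \<noteq> 0"
    and zero: "restrict_poly {t. Poly_Mapping.keys t \<subseteq> V} (\<Sum>es\<in>F. const (c es) * powers xs es) = 0"
    by (rule algebraically_dependent_modulo[OF len]) (rule that)
  have id: "ideal (P 0) polynomial_ring"
    using prime[of 0] by (simp add: primeideal_polynomial_ring_iff)
  have sum: "(\<Sum>es\<in>F. const (c es) * powers xs es) \<in> P 0" (is "?p \<in> _")
  proof (rule mem_ideal_if_monomials[OF id])
    fix t assume t: "t \<in> Poly_Mapping.keys ?p"
    have "\<not> Poly_Mapping.keys t \<subseteq> V"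
    proof
      assume "Poly_Mapping.keys t \<subseteq> V"
      then have "Poly_Mapping.lookup (restrict_poly {t. Poly_Mapping.keys t \<subseteq> V} ?p) t = Poly_Mapping.lookup ?p t"
        by (simp add: lookup_restrict_poly)
      then show False using t zero by (simp add: in_keys_iff)
    qed
    then obtain w where w: "w \<in> Poly_Mapping.keys t" "w \<in> - V" by blast
    have "monomial (t - var w) * monomial (var w) \<in> P 0"
      using id vars[OF w(2)] by (simp add: ideal_polynomial_ring_iff)
    then show "monomial t \<in> P 0"
      using exponent_split_var[OF w(1)] by (metis monomial_add)
  qed
  have "c es = 0"
  proof (rule chain_algebraically_independent[where xs = xs and P = P and F = F and c = c, OF _ _ F(1,2) sum F(3)])
    show "primeideal (P i) polynomial_ring" if "i \<le> length xs" for i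
      using prime that n len by simp
    show "P i \<subseteq> P (Suc i) \<and> xs ! i \<in> P (Suc i) - P i" if "i < length xs" for i
      using strict[of i] x[of i] nth[OF that] that n len by auto
  qed
  then show False using F(4) by simp
qed

text \<open>A leading term argument that ignores monomials involving \<open>W\<close>: the product
  of the leading terms of two polynomials outside the ideal survives in their product.\<close>

lemma prime_variable_ideal:
  fixes W :: "'v::finite set"
  shows "primeideal (polys_on {t. Poly_Mapping.keys t \<inter> W \<noteq> {}} :: ('v, 'k::field) mpoly set) polynomial_ring"
proof -
  let ?A = "{t. Poly_Mapping.keys t \<inter> W \<noteq> {}}"
  let ?P = "polys_on ?A :: ('v, 'k) mpoly set"
  have keys_add: "Poly_Mapping.keys (s + t) = Poly_Mapping.keys s \<union> Poly_Mapping.keys t" for s t :: "'v \<Rightarrow>\<^sub>0 nat"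
    by (auto simp: in_keys_iff lookup_add)
  have "up_closed ?A" by (auto simp: up_closed_def keys_add)
  obtain f :: "'v \<Rightarrow> nat" where f: "inj f"
    using finite_imp_inj_to_nat_seg[of "UNIV :: 'v set"] by auto
  \<comment> \<open>the lexicographic order of the library needs linearly ordered variables\<close>
  define \<psi> where "\<psi> t = (\<Sum>v\<in>UNIV. Poly_Mapping.single (f v) (Poly_Mapping.lookup t v))" for t :: "'v \<Rightarrow>\<^sub>0 nat"
  have \<psi>_add: "\<psi> (s + t) = \<psi> s + \<psi> t" for s t
    by (simp add: \<psi>_def lookup_add single_add sum.distrib)
  have \<psi>_lookup: "Poly_Mapping.lookup (\<psi> t) (f v) = Poly_Mapping.lookup t v" for t v
    using f by (simp add: \<psi>_def lookup_sum lookup_single when_def inj_eq)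
  have \<psi>_inj: "s = t" if "\<psi> s = \<psi> t" for s t
    using that \<psi>_lookup by (metis poly_mapping_eqI)
  have lead: "\<exists>a. a \<in> Poly_Mapping.keys p - ?A \<and> (\<forall>b\<in>Poly_Mapping.keys p - ?A. \<psi> b \<le> \<psi> a)"
    if "p \<notin> ?P" for p
  proof -
    let ?K = "Poly_Mapping.keys p - ?A"
    have "?K \<noteq> {}" using that by (auto simp: polys_on_def)
    then have "Max (\<psi> ` ?K) \<in> \<psi> ` ?K" by (intro Max_in finite_imageI finite_Diff finite_keys) blast
    then obtain a where a: "Max (\<psi> ` ?K) = \<psi> a" "a \<in> ?K" by (rule imageE)
    have "\<psi> b \<le> \<psi> a" if "b \<in> ?K" for b
      unfolding a(1)[symmetric] using that by (intro Max_ge finite_imageI finite_Diff finite_keys imageI)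
    then show ?thesis using a(2) by blast
  qed
  have "p \<in> ?P \<or> q \<in> ?P" if pq: "p * q \<in> ?P" for p q
  proof (rule ccontr)
    assume "\<not> (p \<in> ?P \<or> q \<in> ?P)"
    then obtain a b where a: "a \<in> Poly_Mapping.keys p - ?A" "\<And>c. c \<in> Poly_Mapping.keys p - ?A \<Longrightarrow> \<psi> c \<le> \<psi> a"
      and b: "b \<in> Poly_Mapping.keys q - ?A" "\<And>c. c \<in> Poly_Mapping.keys q - ?A \<Longrightarrow> \<psi> c \<le> \<psi> b"
      using lead by meson
    \<comment> \<open>Since \<open>a + b\<close> avoids \<open>W\<close>, both summands
      \<open>c\<close> and \<open>d\<close> do as well, so they are bounded by the leading
      exponents; the equal sum then forces equality.\<close>
    have eq: "c = a \<and> d = b"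
      if "c \<in> Poly_Mapping.keys p" "d \<in> Poly_Mapping.keys q" "c + d = a + b" for c d
    proof -
      have "Poly_Mapping.keys c \<union> Poly_Mapping.keys d = Poly_Mapping.keys a \<union> Poly_Mapping.keys b"
        using that(3) by (metis keys_add)
      then have le: "\<psi> c \<le> \<psi> a" "\<psi> d \<le> \<psi> b" using a b that(1,2) by blast+
      have sum: "\<psi> c + \<psi> d = \<psi> a + \<psi> b" using that(3) by (metis \<psi>_add)
      have "\<psi> c = \<psi> a"
      proof (rule ccontr)
        assume "\<psi> c \<noteq> \<psi> a"
        then have "\<psi> c < \<psi> a" using le(1) by simp
        then have "\<psi> c + \<psi> d < \<psi> a + \<psi> b" using le(2) by (rule add_less_le_mono)
        then show False using sum by simp
      qed
      then have "\<psi> c = \<psi> a" "\<psi> d = \<psi> b" using sum by simp_all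
      then show ?thesis using \<psi>_inj by blast
    qed
    have "Poly_Mapping.lookup (p * q) (a + b) = (\<Sum>c\<in>Poly_Mapping.keys p. \<Sum>d\<in>Poly_Mapping.keys q.
        if c = a \<and> d = b then Poly_Mapping.lookup p a * Poly_Mapping.lookup q b else 0)"
      unfolding lookup_times_eq_sum using eq by (intro sum.cong refl) auto
    also have "\<dots> = (\<Sum>c\<in>Poly_Mapping.keys p.
        if c = a then \<Sum>d\<in>Poly_Mapping.keys q. if d = b then Poly_Mapping.lookup p a * Poly_Mapping.lookup q b else 0 else 0)"
      by (intro sum.cong refl) auto
    also have "\<dots> = Poly_Mapping.lookup p a * Poly_Mapping.lookup q b"
      using a(1) b(1) by simp
    finally have "a + b \<in> Poly_Mapping.keys (p * q)" using a(1) b(1) by (simp add: in_keys_iff)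
    then have "a + b \<in> ?A" using pq unfolding polys_on_def by blast
    then show False using a(1) b(1) keys_add[of a b] by auto
  qed
  then show ?thesis
    unfolding primeideal_polynomial_ring_iff
    using ideal_polys_on[OF \<open>up_closed ?A\<close>] by (simp add: polys_on_def)
qed

context disjoint_exponents
begin

theorem krull_dim_quotient_heavy:
  "krull_dim (polynomial_ring Quot (polys_on (heavy 1) :: ('v, 'k::field) mpoly set)) = enat (CARD('v) - m)"
proof -
  let ?J = "polys_on (heavy 1) :: ('v, 'k) mpoly set"
  interpret ideal ?J "polynomial_ring :: ('v, 'k) mpoly ring"
    by (rule ideal_polys_on[OF up_closed_heavy])
  let ?chain = "\<lambda>n p. (\<forall>i\<le>n. primeideal (p i) (polynomial_ring :: ('v, 'k) mpoly ring) \<and> ?J \<subseteq> p i) \<and>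
      (\<forall>i<n. p i \<subset> p (Suc i))"
  have upper: "n \<le> CARD('v) - m" if chain: "?chain n p" for n p
  proof -
    have "\<exists>v\<in>supp j. monomial (var v) \<in> p 0" if j: "j < m" for j
    proof -
      have "monomial (u j) \<in> ?J" using weight_u[OF j] by (simp add: heavy_def)
      then show ?thesis using chain prime_contains_variable[of "p 0" "u j"] by blast
    qed
    then obtain w where w: "\<And>j. j < m \<Longrightarrow> w j \<in> supp j \<and> monomial (var (w j)) \<in> p 0" by metis
    have "n \<le> card (- w ` {..<m})"
      using chain w by (intro prime_chain_length_le[of n p]) auto
    then show ?thesis using card_avoiding[of m w] w by auto
  qed
  have "\<exists>p. ?chain (CARD('v) - m) p"
  proof -
    have "\<forall>j. \<exists>v. j < m \<longrightarrow> v \<in> supp j" using supp_nonempty by blast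
    then obtain w where w: "\<And>j. j < m \<Longrightarrow> w j \<in> supp j" by metis
    \<comment> \<open>Start from one variable per support, which already yields a prime containing
      the ideal, and adjoin the other \<open>CARD('v) - m\<close> variables one by one.\<close>
    let ?W = "w ` {..<m}"
    obtain l where l: "set l = - ?W" "distinct l" using finite_distinct_list[of "- ?W"] by auto
    have len: "length l = CARD('v) - m"
      using card_avoiding[of m w] w distinct_card[OF l(2)] by (simp add: l(1))
    define W where "W i = ?W \<union> set (take i l)" for i
    define p where "p i = (polys_on {t. Poly_Mapping.keys t \<inter> W i \<noteq> {}} :: ('v, 'k) mpoly set)" for i
    have "?J \<subseteq> p i" for i
      unfolding p_def
    proof (rule polys_on_mono, rule subsetI)
      fix t assume "t \<in> heavy 1"
      then obtain j s where j: "j < m" "t = u j + s"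
        unfolding up_closure_u[symmetric] up_closure_def by auto
      then have "w j \<in> Poly_Mapping.keys t" using w[OF j(1)] by (simp add: in_keys_iff lookup_add)
      moreover have "w j \<in> W i" using j(1) by (simp add: W_def)
      ultimately show "t \<in> {t. Poly_Mapping.keys t \<inter> W i \<noteq> {}}" by blast
    qed
    moreover have "primeideal (p i) polynomial_ring" for i
      unfolding p_def by (rule prime_variable_ideal)
    moreover have "p i \<subset> p (Suc i)" if i: "i < CARD('v) - m" for i
    proof -
      have "W (Suc i) = insert (l ! i) (W i)"
        using i len by (auto simp: W_def take_Suc_conv_app_nth)
      moreover have "l ! i \<notin> set (take i l)"
        using l(2) i len by (auto simp: in_set_conv_nth nth_eq_iff_index_eq)
      moreover have "l ! i \<notin> ?W" using l(1) i len nth_mem[of i l] by auto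
      ultimately have new: "l ! i \<in> W (Suc i)" "l ! i \<notin> W i" and sub: "W i \<subseteq> W (Suc i)"
        by (auto simp: W_def)
      have "monomial (var (l ! i)) \<in> p (Suc i)" "monomial (var (l ! i)) \<notin> p i"
        using new by (simp_all add: p_def)
      moreover have "p i \<subseteq> p (Suc i)"
        unfolding p_def by (rule polys_on_mono, rule Collect_mono) (use sub in blast)
      ultimately show ?thesis by blast
    qed
    ultimately show ?thesis by (intro exI[of _ p]) blast
  qed
  then have mem: "enat (CARD('v) - m) \<in> {enat n | n. \<exists>p. ?chain n p}" by blast
  show ?thesis
    unfolding krull_dim_quotient[OF cring_polynomial_ring]
  proof (rule antisym)
    show "Sup {enat n | n. \<exists>p. ?chain n p} \<le> enat (CARD('v) - m)"
      using upper by (intro Sup_least) auto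
    show "enat (CARD('v) - m) \<le> Sup {enat n | n. \<exists>p. ?chain n p}"
      by (rule Sup_upper[OF mem])
  qed
qed

end

section \<open>Complete intersections\<close>

text \<open>A variable shared by two generators produces a zero divisor: the later one times the
  earlier one divided by their gcd is a multiple of the earlier one. Regularity and minimality
  exclude this.\<close>

lemma complete_intersection_disjoint_exponents:
  fixes J :: "('v::finite, 'k::field) mpoly set"
  assumes "complete_intersection J" "J \<noteq> {0}" "J \<noteq> carrier polynomial_ring"
  obtains u m where "disjoint_exponents u m" "J = polys_on (up_closure (u ` {..<m}))"
proof -
  obtain ts where "distinct ts" and min: "minimal_monomial_generators J (set ts)"
    and reg: "regular_sequence polynomial_ring (map monomial ts :: ('v, 'k) mpoly list)"
    using assms(1) by (auto simp: complete_intersection_def)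
  have J: "J = polys_on (up_closure (set ts))"
    using min by (simp add: minimal_monomial_generators_def genideal_monomials)
  have minimal: "up_closure T' \<noteq> up_closure (set ts)" if "T' \<subset> set ts" for T'
  proof -
    have "polys_on (up_closure T') \<noteq> J"
      using min that unfolding minimal_monomial_generators_def genideal_monomials by blast
    then show ?thesis unfolding J by metis
  qed
  \<comment> \<open>A generator that is a multiple of another one could be dropped.\<close>
  have antichain: "a = b" if ab: "a \<in> set ts" "b \<in> set ts" "b = a + s" for a b s
  proof (rule ccontr)
    assume "a \<noteq> b"
    have "up_closure (set ts - {b}) = up_closure (set ts)"
    proof
      show "up_closure (set ts) \<subseteq> up_closure (set ts - {b})"
      proof
        fix t assume "t \<in> up_closure (set ts)"
        then obtain c r where c: "c \<in> set ts" "t = c + r" by (auto simp: up_closure_def)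
        show "t \<in> up_closure (set ts - {b})"
        proof (cases "c = b")
          case True
          then have "t = a + (s + r)" using c(2) ab(3) by (simp add: add.assoc)
          moreover have "a \<in> set ts - {b}" using ab(1) \<open>a \<noteq> b\<close> by simp
          ultimately show ?thesis unfolding up_closure_def by blast
        qed (use c in \<open>auto simp: up_closure_def\<close>)
      qed
    qed (auto simp: up_closure_def)
    moreover have "set ts - {b} \<subset> set ts" using ab(2) by blast
    ultimately show False using minimal by blast
  qed
  have disj: "Poly_Mapping.keys (ts ! i) \<inter> Poly_Mapping.keys (ts ! j) = {}" if ij: "i < j" "j < length ts" for i j
  proof (rule ccontr)
    assume "Poly_Mapping.keys (ts ! i) \<inter> Poly_Mapping.keys (ts ! j) \<noteq> {}"
    then obtain v where v: "v \<in> Poly_Mapping.keys (ts ! i)" "v \<in> Poly_Mapping.keys (ts ! j)" by blast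
    \<comment> \<open>Truncated subtraction makes this the exponent of \<open>ts ! i\<close> divided
      by the gcd, so \<open>ts ! j + ?r\<close> is the lcm of the two.\<close>
    let ?r = "ts ! i - ts ! j"
    have Idl: "Idl\<^bsub>polynomial_ring\<^esub> (set (take j (map monomial ts))) =
        (polys_on (up_closure (set (take j ts))) :: ('v, 'k) mpoly set)"
      by (simp add: take_map genideal_monomials)
    have i: "ts ! i \<in> set (take j ts)" using ij by (auto simp: in_set_conv_nth intro!: exI[of _ i])
    have "\<forall>w. Poly_Mapping.lookup (ts ! i) w \<le> Poly_Mapping.lookup (ts ! j + ?r) w"
      unfolding lookup_add lookup_minus by (intro allI) linarith
    then obtain s where "ts ! j + ?r = ts ! i + s"
      using exponent_le_iff[where a = "ts ! i" and b = "ts ! j + ?r"] by blast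
    then have "ts ! j + ?r \<in> up_closure (set (take j ts))"
      using i unfolding up_closure_def by blast
    then have "monomial (ts ! j) * monomial ?r \<in>
        (polys_on (up_closure (set (take j ts))) :: ('v, 'k) mpoly set)"
      by (simp flip: monomial_add)
    then have "monomial ?r \<in> (polys_on (up_closure (set (take j ts))) :: ('v, 'k) mpoly set)"
      using reg ij(2) unfolding regular_sequence_def Idl[symmetric] by auto
    then obtain a s where a: "a \<in> set (take j ts)" "?r = a + s"
      by (auto simp: up_closure_def)
    have le: "Poly_Mapping.lookup a w \<le> Poly_Mapping.lookup (ts ! i) w - Poly_Mapping.lookup (ts ! j) w" for w
      using arg_cong[OF a(2), of "\<lambda>t. Poly_Mapping.lookup t w"] by (simp add: lookup_add lookup_minus)
    have "\<forall>w. Poly_Mapping.lookup a w \<le> Poly_Mapping.lookup (ts ! i) w"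
      using le by (meson diff_le_self order_trans)
    then obtain s' where "ts ! i = a + s'"
      using exponent_le_iff[where a = a and b = "ts ! i"] by blast
    then have "a = ts ! i"
      using antichain[of a "ts ! i" s'] a(1) i set_take_subset[of j ts] by blast
    \<comment> \<open>A generator dividing \<open>?r\<close> must be \<open>ts ! i\<close>, but the
      exponent of the shared variable \<open>v\<close> in \<open>?r\<close> is strictly
      smaller.\<close>
    then show False using le[of v] v by (simp add: in_keys_iff)
  qed
  have img: "(!) ts ` {..<length ts} = set ts" by (auto simp: in_set_conv_nth image_iff)
  show thesis
  proof (rule that[of "(!) ts" "length ts"])
    show "J = polys_on (up_closure ((!) ts ` {..<length ts}))" by (simp add: img J)
    show "disjoint_exponents ((!) ts) (length ts)"
    proof
      show "ts ! j \<noteq> 0" if j: "j < length ts" for j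
      proof
        assume "ts ! j = 0"
        then have "t \<in> up_closure (set ts)" for t
          unfolding up_closure_def using nth_mem[OF j] by (intro CollectI exI[of _ 0] exI[of _ t]) simp
        then have "up_closure (set ts) = UNIV" by blast
        then show False using assms(3) J by simp
      qed
      show "Poly_Mapping.keys (ts ! i) \<inter> Poly_Mapping.keys (ts ! j) = {}"
        if "i < length ts" "j < length ts" "i \<noteq> j" for i j
        using disj[of i j] disj[of j i] that by (cases i j rule: linorder_cases) auto
      show "0 < length ts"
        using assms(2) J by (auto simp: up_closure_def)
    qed
  qed
qed

theorem theorem2p15:
  fixes J :: "('v::finite, 'k::field) mpoly set"
  assumes "monomial_ideal J" and "complete_intersection J"
    and "J \<noteq> {0}" and "J \<noteq> carrier polynomial_ring"
  shows "(\<forall>n::nat. n \<ge> 1 \<longrightarrow>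
            enat (sdepth (quotient_module (ideal_module (carrier polynomial_ring)) (ideal_power J n)))
              = krull_dim (polynomial_ring Quot J)) \<and>
         (\<forall>n::nat.
            enat (sdepth (quotient_module (ideal_module (ideal_power J n)) (ideal_power J (n + 1))))
              = krull_dim (polynomial_ring Quot J)) \<and>
         (\<forall>n::nat. enat CARD('v) \<le> enat n + krull_dim (polynomial_ring Quot J) + 1 \<longrightarrow>
            enat (sdepth (ideal_module (ideal_power J n)))
              = krull_dim (polynomial_ring Quot J) + 1)"
proof -
  obtain u m where "disjoint_exponents u m" and J_eq: "J = polys_on (up_closure (u ` {..<m}))"
    using complete_intersection_disjoint_exponents[OF assms(2-4)] by blast
  then interpret disjoint_exponents u m by simp
  have J: "J = polys_on (heavy 1)" unfolding J_eq up_closure_u ..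
  have power: "ideal_power J n = polys_on (heavy n)" for n
    unfolding J by (rule ideal_power_heavy)
  have dim: "krull_dim (polynomial_ring Quot J) = enat (CARD('v) - m)"
    unfolding J by (rule krull_dim_quotient_heavy)
  have quotient: "sdepth (quotient_module (ideal_module (polys_on (heavy p) :: ('v, 'k) mpoly set))
      (polys_on (heavy n))) = CARD('v) - m" if pn: "p < n" for p n
  proof -
    \<comment> \<open>The \<open>p\<close>-th power of the first generator has weight exactly
      \<open>p\<close>, so the quotient is nonzero.\<close>
    have "comb (\<lambda>j. if j = 0 then p else 0) \<in> heavy p - heavy n"
      using pn m_pos by (simp add: heavy_def weight_comb)
    then have "heavy p - heavy n \<noteq> {}" by blast
    then show ?thesis
      by (intro sdepth_quotient[OF monomial_module_quotient] up_closed_heavy)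
  qed
  have "sdepth (quotient_module (ideal_module (carrier polynomial_ring)) (ideal_power J n)) = CARD('v) - m"
    if "n \<ge> 1" for n
    using quotient[of 0 n] that by (simp add: power)
  moreover have "sdepth (quotient_module (ideal_module (ideal_power J n)) (ideal_power J (n + 1))) = CARD('v) - m" for n
    unfolding power by (rule quotient) simp
  moreover have "sdepth (ideal_module (ideal_power J n)) = CARD('v) - m + 1" if n: "m \<le> n + 1" for n
  proof -
    have "comb (\<lambda>j. if j = 0 then n else 0) \<in> heavy n"
      using m_pos by (simp add: heavy_def weight_comb)
    then have "heavy n \<noteq> {}" by blast
    then show ?thesis
      unfolding power by (intro sdepth_power[OF monomial_module_ideal n] up_closed_heavy)
  qed
  \<comment> \<open>The additive bound translates into \<open>m \<le> n + 1\<close> because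
    \<open>m \<le> CARD('v)\<close> makes the subtraction in the dimension exact.\<close>
  moreover have "m \<le> n + 1" if "enat CARD('v) \<le> enat n + enat (CARD('v) - m) + 1" for n
    using that m_le_card by (simp add: one_enat_def)
  ultimately show ?thesis by (simp add: dim one_enat_def)
qed

end
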